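(* Let $M=\mathbf{R}$, $S^1$ or $I$. Then $\mathrm{Diff}_+^1(M)$ contains every finitely generated, residually torsion-free nilpotent group; that is, every such group is isomorphic to a subgroup of $\mathrm{Diff}_+^1(M)$.
   Context: $I=[0,1]$, $S^1$ is the circle, $\mathbf{R}$ is the real line. $\mathrm{Diff}_+^1(M)$ denotes the group of orientation-preserving $C^1$ diffeomorphisms of $M$ (differentiability is understood up to and including boundary points of $M$), under composition. A group $G$ is called residually torsion-free nilpotent if, for every non-trivial element $g\in G$, there is a torsion-free nilpotent group $N$ and a homomorphism $\phi:G\to N$ such that $\phi(g)$ is non-trivial. *)

theory Defs
  imports "HOL-Analysis.Analysis" "HOL-Algebra.Bij" "HOL-Algebra.Generated_Groups"
begin

section \<open>Finitely generated, residually torsion-free nilpotent groups\<close>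

definition finitely_generated_group :: "('a, 'c) monoid_scheme \<Rightarrow> bool" where
  "finitely_generated_group G \<longleftrightarrow>
     group G \<and> (\<exists>A. finite A \<and> A \<subseteq> carrier G \<and> generate G A = carrier G)"

definition torsion_free_group :: "('a, 'c) monoid_scheme \<Rightarrow> bool" where
  "torsion_free_group G \<longleftrightarrow>
     group G \<and> (\<forall>x\<in>carrier G. \<forall>n::nat. n > 0 \<and> x [^]\<^bsub>G\<^esub> n = \<one>\<^bsub>G\<^esub> \<longrightarrow> x = \<one>\<^bsub>G\<^esub>)"

fun lower_central_series :: "('a, 'c) monoid_scheme \<Rightarrow> nat \<Rightarrow> 'a set" where
  "lower_central_series G 0 = carrier G"
| "lower_central_series G (Suc n) =
     generate G (\<Union>h\<in>lower_central_series G n. \<Union>g\<in>carrier G.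
       {h \<otimes>\<^bsub>G\<^esub> g \<otimes>\<^bsub>G\<^esub> inv\<^bsub>G\<^esub> h \<otimes>\<^bsub>G\<^esub> inv\<^bsub>G\<^esub> g})"

definition nilpotent_group :: "('a, 'c) monoid_scheme \<Rightarrow> bool" where
  "nilpotent_group G \<longleftrightarrow> group G \<and> (\<exists>n. lower_central_series G n = {\<one>\<^bsub>G\<^esub>})"

text \<open>HOL cannot quantify over types inside a formula, so the element type \<open>'b\<close> of the target
  groups is a parameter; a theorem assuming this property for a free \<open>'b\<close> covers all
  possible targets.\<close>

definition residually_torsion_free_nilpotent ::
    "'b itself \<Rightarrow> ('a, 'c) monoid_scheme \<Rightarrow> bool" where
  "residually_torsion_free_nilpotent (_ :: 'b itself) G \<longleftrightarrow>
     group G \<and>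
     (\<forall>g\<in>carrier G. g \<noteq> \<one>\<^bsub>G\<^esub> \<longrightarrow>
        (\<exists>(N :: 'b monoid) \<phi>. torsion_free_group N \<and> nilpotent_group N \<and>
           \<phi> \<in> hom G N \<and> \<phi> g \<noteq> \<one>\<^bsub>N\<^esub>))"

definition isomorphic_to_subgroup ::
    "('a, 'c) monoid_scheme \<Rightarrow> ('b, 'd) monoid_scheme \<Rightarrow> bool" where
  "isomorphic_to_subgroup G D \<longleftrightarrow> (\<exists>H. subgroup H D \<and> G \<cong> D\<lparr>carrier := H\<rparr>)"

section \<open>Groups of orientation-preserving diffeomorphisms of class \<open>C\<^sup>1\<close>\<close>

text \<open>The library notion \<open>C1_differentiable_on\<close> asks for two-sided derivatives; taking
  derivatives within \<open>S\<close> gives the one-sided ones at the endpoints of \<open>S\<close>.\<close>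

definition C1_within :: "real set \<Rightarrow> (real \<Rightarrow> 'a::real_normed_vector) \<Rightarrow> bool" where
  "C1_within S f \<longleftrightarrow>
     (\<exists>f'. continuous_on S f' \<and> (\<forall>x\<in>S. (f has_vector_derivative f' x) (at x within S)))"

text \<open>\<open>S\<close> is meant to be \<open>UNIV\<close> or a nondegenerate interval.\<close>

definition Diff1_real :: "real set \<Rightarrow> (real \<Rightarrow> real) monoid" where
  "Diff1_real S = BijGroup S\<lparr>carrier :=
     {f \<in> Bij S. C1_within S f \<and> C1_within S (inv_into S f) \<and>
        (\<forall>x\<in>S. \<exists>d>0. (f has_real_derivative d) (at x within S))}\<rparr>"

abbreviation circle :: "complex set" where
  "circle \<equiv> sphere 0 1"

text \<open>The map \<open>cis t = exp (\<i> t)\<close> is a local diffeomorphism from the line onto the circle, so a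
  self-map \<open>f\<close> of the circle is \<open>C\<^sup>1\<close> iff \<open>f \<circ> cis\<close> is.  The positively oriented unit tangent
  vector at a point \<open>z\<close> of the circle is \<open>\<i> * z\<close>, and \<open>\<i> * cis t\<close> is the derivative of \<open>cis\<close> at
  \<open>t\<close>; hence the last condition says that the differential of \<open>f\<close> preserves orientation at every
  point.\<close>

definition Diff1_circle :: "(complex \<Rightarrow> complex) monoid" where
  "Diff1_circle = BijGroup circle\<lparr>carrier :=
     {f \<in> Bij circle. C1_within UNIV (f \<circ> cis) \<and> C1_within UNIV (inv_into circle f \<circ> cis) \<and>
        (\<forall>t. \<exists>r>0. ((f \<circ> cis) has_vector_derivative r *\<^sub>R (\<i> * f (cis t))) (at t))}\<rparr>"

end

theory Submission
  imports Defs
begin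

text \<open>A group that acts faithfully by order automorphisms on a countable totally ordered set
  \<open>\<Omega>\<close> acts on \<open>[0, 1]\<close>: give \<open>\<omega>\<close> an interval of length \<open>l \<omega>\<close>, with \<open>\<Sum>\<omega>. l \<omega> = 1\<close>, lay the
  intervals out in the order of \<open>\<Omega>\<close>, and map the interval of \<open>\<omega>\<close> to that of \<open>g \<omega>\<close> by a family of
  diffeomorphisms that is compatible with composition and has derivative \<open>1\<close> at the end points.
  This action is by \<open>C\<^sup>1\<close> diffeomorphisms as soon as \<open>l (g \<omega>) / l \<omega>\<close> tends to \<open>1\<close> at infinity in
  \<open>\<Omega>\<close>, for every \<open>g\<close>.

  A torsion-free nilpotent group has a left order, since the factors of its upper central series
  are torsion-free abelian. A finitely generated nilpotent group has polynomial growth, so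
  \<open>l h = 1 / (K + len h) ^ p\<close> is summable for large \<open>p\<close>, its translates have ratio tending to \<open>1\<close>, and
  for large \<open>K\<close> the ratio is uniformly close to \<open>1\<close> for finitely many given elements. If \<open>G\<close> is
  finitely generated and residually torsion-free nilpotent, then countably many torsion-free
  nilpotent images \<open>H i\<close> of \<open>G\<close> separate its elements, and \<open>G\<close> acts on their disjoint union, ordered
  lexicographically; taking the ratios on \<open>H i\<close> within \<open>1 / (i + 1)\<close> of \<open>1\<close> for the first \<open>i\<close>
  elements of \<open>G\<close> makes the combined weight satisfy the condition above.\<close>

section \<open>Positive cones of torsion-free nilpotent groups\<close>

context group
begin

section \<open>Commutators and the upper central series\<close>

lemma inv_cancel_left:
  assumes "x \<in> carrier G" "y \<in> carrier G"
  shows "x \<otimes> (inv x \<otimes> y) = y" "inv x \<otimes> (x \<otimes> y) = y"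
  using assms by (simp_all add: m_assoc[symmetric])

lemmas word_simps = m_assoc inv_mult_group inv_cancel_left

text \<open>Commutators stand in for the centre of the quotient by the previous term, so no quotient
  group has to be formed.\<close>

primrec upper_central_series :: "nat \<Rightarrow> 'a set" where
  "upper_central_series 0 = {\<one>}"
| "upper_central_series (Suc n) =
     {h \<in> carrier G. \<forall>g\<in>carrier G. h \<otimes> g \<otimes> inv h \<otimes> inv g \<in> upper_central_series n}"

lemma upper_central_closed: "upper_central_series n \<subseteq> carrier G"
  by (cases n) auto

lemmas [simp del] = upper_central_series.simps(2) lower_central_series.simps(2)

lemma upper_central_SucI:
  assumes "h \<in> carrier G" "\<And>g. g \<in> carrier G \<Longrightarrow> h \<otimes> g \<otimes> inv h \<otimes> inv g \<in> upper_central_series n"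
  shows "h \<in> upper_central_series (Suc n)"
  using assms by (simp add: upper_central_series.simps(2))

lemma upper_central_closedD [dest]: "h \<in> upper_central_series n \<Longrightarrow> h \<in> carrier G"
  using upper_central_closed by blast

lemma upper_central_SucD:
  assumes "h \<in> upper_central_series (Suc n)" "g \<in> carrier G"
  shows "h \<otimes> g \<otimes> inv h \<otimes> inv g \<in> upper_central_series n"
  using assms by (simp add: upper_central_series.simps(2))

text \<open>Each closure property reduces to normality of the previous term by a commutator
  identity: \<open>[h k, g] = h [k, g] h^-1 [h, g]\<close>,
  \<open>[h^-1, g] = h^-1 [h, g]^-1 h\<close> and
  \<open>[x h x^-1, g] = x [h, x^-1 g x] x^-1\<close>.\<close>

lemma upper_central_normal: "upper_central_series n \<lhd> G"
proof (induction n)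
  case 0
  then show ?case by (simp add: one_is_normal)
next
  case (Suc n)
  let ?Z = "upper_central_series n"
  interpret Z: normal ?Z G by (rule Suc)
  have "subgroup (upper_central_series (Suc n)) G"
  proof
    show "upper_central_series (Suc n) \<subseteq> carrier G" by (rule upper_central_closed)
    show "\<one> \<in> upper_central_series (Suc n)" by (rule upper_central_SucI) auto
  next
    fix h k assume h: "h \<in> upper_central_series (Suc n)" and k: "k \<in> upper_central_series (Suc n)"
    then have [simp]: "h \<in> carrier G" "k \<in> carrier G" by auto
    show "h \<otimes> k \<in> upper_central_series (Suc n)"
    proof (rule upper_central_SucI)
      show "h \<otimes> k \<in> carrier G" by simp
    next
      fix g assume g: "g \<in> carrier G"
      have "h \<otimes> (k \<otimes> g \<otimes> inv k \<otimes> inv g) \<otimes> inv h \<otimes> (h \<otimes> g \<otimes> inv h \<otimes> inv g) \<in> ?Z"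
        using g by (intro Z.m_closed Z.inv_op_closed2 upper_central_SucD[OF h] upper_central_SucD[OF k]) auto
      then show "h \<otimes> k \<otimes> g \<otimes> inv (h \<otimes> k) \<otimes> inv g \<in> ?Z"
        using g by (simp add: word_simps)
    qed
  next
    fix h assume h: "h \<in> upper_central_series (Suc n)"
    then have [simp]: "h \<in> carrier G" by auto
    show "inv h \<in> upper_central_series (Suc n)"
    proof (rule upper_central_SucI)
      show "inv h \<in> carrier G" by simp
    next
      fix g assume g: "g \<in> carrier G"
      have "inv h \<otimes> inv (h \<otimes> g \<otimes> inv h \<otimes> inv g) \<otimes> h \<in> ?Z"
        using g by (intro Z.inv_op_closed1 Z.m_inv_closed upper_central_SucD[OF h]) auto
      then show "inv h \<otimes> g \<otimes> inv (inv h) \<otimes> inv g \<in> ?Z"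
        using g by (simp add: word_simps)
    qed
  qed
  moreover have "x \<otimes> h \<otimes> inv x \<in> upper_central_series (Suc n)"
    if x: "x \<in> carrier G" and h: "h \<in> upper_central_series (Suc n)" for x h
  proof (rule upper_central_SucI)
    have hc: "h \<in> carrier G" using h by auto
    show "x \<otimes> h \<otimes> inv x \<in> carrier G" using x h by auto
    fix g assume g: "g \<in> carrier G"
    have "x \<otimes> (h \<otimes> (inv x \<otimes> g \<otimes> x) \<otimes> inv h \<otimes> inv (inv x \<otimes> g \<otimes> x)) \<otimes> inv x \<in> ?Z"
      using g x by (intro Z.inv_op_closed2 upper_central_SucD[OF h]) auto
    then show "x \<otimes> h \<otimes> inv x \<otimes> g \<otimes> inv (x \<otimes> h \<otimes> inv x) \<otimes> inv g \<in> ?Z"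
      using g x hc by (simp add: word_simps)
  qed
  ultimately show ?case by (simp add: normal_inv_iff del: upper_central_series.simps)
qed

lemma upper_central_mono: "upper_central_series n \<subseteq> upper_central_series (Suc n)"
proof
  fix h assume h: "h \<in> upper_central_series n"
  interpret Z: normal "upper_central_series n" G by (rule upper_central_normal)
  show "h \<in> upper_central_series (Suc n)"
  proof (rule upper_central_SucI)
    show "h \<in> carrier G" using h upper_central_closed by blast
  next
    fix g assume g: "g \<in> carrier G"
    have "h \<otimes> (g \<otimes> inv h \<otimes> inv g) \<in> upper_central_series n"
      using h g by (intro Z.m_closed Z.inv_op_closed2) auto
    then show "h \<otimes> g \<otimes> inv h \<otimes> inv g \<in> upper_central_series n"
      using h g by (simp add: word_simps)
  qed
qed

lemma lower_central_closed: "lower_central_series G n \<subseteq> carrier G"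
proof (induction n)
  case (Suc n)
  then show ?case
    unfolding lower_central_series.simps by (intro generate_incl UN_least) auto
qed simp

lemma lower_central_commutator:
  assumes "h \<in> lower_central_series G n" "g \<in> carrier G"
  shows "h \<otimes> g \<otimes> inv h \<otimes> inv g \<in> lower_central_series G (Suc n)"
  unfolding lower_central_series.simps using assms by (intro generate.incl) blast

text \<open>The two series run in opposite directions: commutators with elements of lower term
  \<open>n - Suc i\<close> lie in lower term \<open>n - i\<close>, which the induction hypothesis
  places in upper term \<open>i\<close>.\<close>

lemma lower_central_le_upper_central:
  assumes "lower_central_series G n = {\<one>}" "i \<le> n"
  shows "lower_central_series G (n - i) \<subseteq> upper_central_series i"
  using assms(2)
proof (induction i)
  case 0
  then show ?case using assms by simp
next
  case (Suc i)
  then have eq: "Suc (n - Suc i) = n - i" by simp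
  show ?case
  proof
    fix h assume h: "h \<in> lower_central_series G (n - Suc i)"
    then show "h \<in> upper_central_series (Suc i)"
      using lower_central_commutator[OF h] Suc lower_central_closed[of "n - Suc i"] eq
      by (intro upper_central_SucI) auto
  qed
qed

lemma upper_central_eventually_carrier:
  assumes "nilpotent_group G"
  shows "\<exists>n. upper_central_series n = carrier G"
proof -
  obtain n where "lower_central_series G n = {\<one>}"
    using assms by (auto simp: nilpotent_group_def)
  from lower_central_le_upper_central[OF this, of n] show ?thesis
    using upper_central_closed by (intro exI[of _ n]) auto
qed

text \<open>If \<open>x\<close> is central modulo the term above, then \<open>[x\<^sup>n, g]\<close> and \<open>[x, g]\<^sup>n\<close> agree modulo the
  term below, so torsion-freeness climbs up the series.\<close>

lemma upper_central_factor_torsion_free: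
  assumes "torsion_free_group G"
    and "x \<in> upper_central_series (Suc i)" "0 < n" "x [^] (n::nat) \<in> upper_central_series i"
  shows "x \<in> upper_central_series i"
  using assms(2-)
proof (induction i arbitrary: x)
  case 0
  then show ?case using assms(1) by (auto simp: torsion_free_group_def)
next
  case (Suc i)
  let ?Z = "upper_central_series i"
  interpret Z: normal ?Z G by (rule upper_central_normal)
  interpret Z': normal "upper_central_series (Suc i)" G by (rule upper_central_normal)
  have x: "x \<in> carrier G" using Suc.prems(1) upper_central_closed by blast
  show ?case
  proof (rule upper_central_SucI[OF x])
    fix g assume g: "g \<in> carrier G"
    define y where "y = x \<otimes> g \<otimes> inv x \<otimes> inv g"
    have y: "y \<in> carrier G" using x g by (simp add: y_def)
    have yZ: "y \<in> upper_central_series (Suc i)"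
      using Suc.prems(1) g unfolding y_def by (rule upper_central_SucD)
    \<comment> \<open>From \<open>x^(k+1) = x x^k\<close> follows
      \<open>[x^(k+1), g] = x [x^k, g] x^-1 y\<close>. Moving \<open>y^-k\<close> past
      \<open>x\<close> costs a commutator in \<open>?Z\<close>, because \<open>y\<close> lies only
      one term above.\<close>
    have step: "inv (y [^] k) \<otimes> (x [^] k \<otimes> g \<otimes> inv (x [^] k) \<otimes> inv g) \<in> ?Z" for k :: nat
    proof (induction k)
      case (Suc k)
      define z where "z = inv (y [^] k) \<otimes> (x [^] k \<otimes> g \<otimes> inv (x [^] k) \<otimes> inv g)"
      have z: "z \<in> ?Z" "z \<in> carrier G" using Suc by (auto simp: z_def)
      have "inv (y [^] k) \<in> upper_central_series (Suc i)"
        using yZ Z'.m_inv_closed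
        by (metis Z'.subgroup_axioms int_pow_int subgroup_int_pow_closed)
      then have c: "inv (y [^] k) \<otimes> x \<otimes> inv (inv (y [^] k)) \<otimes> inv x \<in> ?Z"
using x by (rule upper_central_SucD)
      have "inv y \<otimes> (inv (y [^] k) \<otimes> x \<otimes> inv (inv (y [^] k)) \<otimes> inv x \<otimes> (x \<otimes> z \<otimes> inv x)) \<otimes> y \<in> ?Z"
        by (rule Z.inv_op_closed1[OF y Z.m_closed[OF c Z.inv_op_closed2[OF x z(1)]]])
      also have "inv y \<otimes> (inv (y [^] k) \<otimes> x \<otimes> inv (inv (y [^] k)) \<otimes> inv x \<otimes> (x \<otimes> z \<otimes> inv x)) \<otimes> y
        = inv (y [^] k \<otimes> y) \<otimes> (x \<otimes> (x [^] k \<otimes> g \<otimes> inv (x [^] k) \<otimes> inv g) \<otimes> inv x \<otimes> y)"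
        unfolding z_def using x y g by (simp add: word_simps)
      also have "x \<otimes> (x [^] k \<otimes> g \<otimes> inv (x [^] k) \<otimes> inv g) \<otimes> inv x \<otimes> y
        = (x \<otimes> x [^] k) \<otimes> g \<otimes> inv (x \<otimes> x [^] k) \<otimes> inv g"
        unfolding y_def using x g by (simp add: word_simps)
      also have "x \<otimes> x [^] k = x [^] Suc k" using x by (rule nat_pow_Suc2[symmetric])
      finally show ?case by simp
    qed (use g in simp)
    have "y [^] n \<otimes> (inv (y [^] n) \<otimes> (x [^] n \<otimes> g \<otimes> inv (x [^] n) \<otimes> inv g)) \<in> ?Z"
      using upper_central_SucD[OF Suc.prems(3) g] x y g by (simp add: inv_cancel_left)
    then have "y [^] n \<in> ?Z"
      using step[of n] y g x
      by (metis Z.m_closed Z.m_inv_closed inv_solve_right m_closed nat_pow_closed inv_closed)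
    then show "x \<otimes> g \<otimes> inv x \<otimes> inv g \<in> ?Z"
      using Suc.IH[OF yZ \<open>0 < n\<close>] by (simp add: y_def)
  qed
qed

section \<open>Cones relative to a term of the upper central series\<close>

text \<open>The preimage in the group of a subsemigroup of the quotient by term \<open>i\<close>
  that misses the identity. The empty set qualifies and starts both the Zorn argument and the final
  induction.\<close>

definition relative_cone :: "nat \<Rightarrow> 'a set \<Rightarrow> bool" where
  "relative_cone i R \<longleftrightarrow> R \<subseteq> carrier G \<and> (\<forall>r\<in>R. \<forall>s\<in>R. r \<otimes> s \<in> R) \<and>
     (\<forall>r\<in>R. \<forall>z\<in>upper_central_series i. r \<otimes> z \<in> R) \<and> R \<inter> upper_central_series i = {}"

text \<open>Normality turns right invariance into left invariance:
  \<open>z r = r (r^-1 z r)\<close>.\<close>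

lemma relative_cone_mult_left:
  assumes "relative_cone i R" "r \<in> R" "z \<in> upper_central_series i"
  shows "z \<otimes> r \<in> R"
proof -
  interpret Z: normal "upper_central_series i" G by (rule upper_central_normal)
  have c: "r \<in> carrier G" "z \<in> carrier G" using assms by (auto simp: relative_cone_def)
  have "r \<otimes> (inv r \<otimes> z \<otimes> r) \<in> R"
    using assms(1,2) Z.inv_op_closed1[OF c(1) assms(3)] unfolding relative_cone_def by blast
  then show ?thesis using c by (simp add: word_simps)
qed

text \<open>Term \<open>i + 1\<close> is central modulo term \<open>i\<close>, so \<open>S\<close>
  is the semigroup that \<open>R\<close> and \<open>x\<close> generate modulo term \<open>i\<close>.
  It can fail to be a cone only if some \<open>r x^n\<close> falls into term \<open>i\<close>, which
  would put \<open>x^n\<close> into term \<open>i\<close> or \<open>x^-n\<close> into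
  \<open>R\<close>.\<close>

lemma relative_cone_adjoin:
  assumes R: "relative_cone i R" "R \<subseteq> upper_central_series (Suc i)"
    and x: "x \<in> upper_central_series (Suc i)"
    and nz: "\<And>n::nat. 0 < n \<Longrightarrow> x [^] n \<notin> upper_central_series i"
    and nr: "\<And>n::nat. 0 < n \<Longrightarrow> inv (x [^] n) \<notin> R"
  defines "S \<equiv> {r \<otimes> x [^] n | r n. r \<in> R \<or> r \<in> upper_central_series i \<and> 0 < (n::nat)}"
  shows "relative_cone i S" "S \<subseteq> upper_central_series (Suc i)" "x \<in> S" "R \<subseteq> S"
proof -
  let ?Z = "upper_central_series i"
  interpret Z: normal ?Z G by (rule upper_central_normal)
  interpret Z': normal "upper_central_series (Suc i)" G by (rule upper_central_normal)
  have xc [simp]: "x \<in> carrier G" using x by auto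
  have R_mult: "r \<otimes> s \<in> R" if "r \<in> R" "s \<in> R" for r s
    using that R by (auto simp: relative_cone_def)
  have RZ: "r \<otimes> z \<in> R" if "r \<in> R" "z \<in> ?Z" for r z
    using that R by (auto simp: relative_cone_def)
  have ZR: "z \<otimes> r \<in> R" if "r \<in> R" "z \<in> ?Z" for r z
    using that R relative_cone_mult_left by blast
  have RZ_disj: "r \<notin> ?Z" if "r \<in> R" for r
    using that R by (auto simp: relative_cone_def)
  have R_carr: "r \<in> carrier G" if "r \<in> R" for r using that R by (auto simp: relative_cone_def)
  have pow: "x [^] n \<in> upper_central_series (Suc i)" for n :: nat
    using x by (induction n) (auto intro: Z'.m_closed)
  show xS: "x \<in> S" unfolding S_def mem_Collect_eq
    by (rule exI[of _ \<one>], rule exI[of _ 1]) auto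
  show RS: "R \<subseteq> S"
  proof
    fix r assume "r \<in> R"
    then show "r \<in> S" unfolding S_def mem_Collect_eq
      by (intro exI[of _ r] exI[of _ 0]) (auto dest: R_carr)
  qed
  show SZ: "S \<subseteq> upper_central_series (Suc i)"
    unfolding S_def using R(2) pow upper_central_mono[of i] by (auto intro!: Z'.m_closed)
  have S_mult: "(r \<otimes> x [^] n) \<otimes> (s \<otimes> x [^] m) \<in> S"
    if rn: "r \<in> R \<or> r \<in> ?Z \<and> 0 < n" and sm: "s \<in> R \<or> s \<in> ?Z \<and> 0 < m" for r s and n m :: nat
  proof -
    have s: "s \<in> upper_central_series (Suc i)" "s \<in> carrier G" and r: "r \<in> carrier G"
      using that R(2) R_carr upper_central_mono[of i] by auto
    \<comment> \<open>The cost of moving \<open>x^n\<close> to the right past \<open>s\<close>: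
      \<open>x^n s = s z x^n\<close>.\<close>
    define z where "z = inv s \<otimes> x [^] n \<otimes> inv (inv s) \<otimes> inv (x [^] n)"
    have z: "z \<in> ?Z" unfolding z_def
      by (rule upper_central_SucD) (use s in auto)
    have "r \<otimes> s \<otimes> z \<in> R \<or> r \<otimes> s \<otimes> z \<in> ?Z \<and> 0 < n + m"
      using rn sm z R_mult RZ ZR Z.m_closed by (metis add_gr_0)
    moreover have "(r \<otimes> x [^] n) \<otimes> (s \<otimes> x [^] m) = r \<otimes> s \<otimes> z \<otimes> x [^] (n + m)"
      unfolding z_def using r s by (simp add: word_simps nat_pow_mult[symmetric])
    ultimately show ?thesis unfolding S_def by blast
  qed
  have S_Z: "(r \<otimes> x [^] n) \<otimes> z \<in> S"
    if rn: "r \<in> R \<or> r \<in> ?Z \<and> 0 < n" and z: "z \<in> ?Z" for r z and n :: nat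
  proof -
    have r: "r \<in> carrier G" using that R_carr by auto
    have z': "x [^] n \<otimes> z \<otimes> inv (x [^] n) \<in> ?Z"
      using z by (intro Z.inv_op_closed2) auto
    then have "r \<otimes> (x [^] n \<otimes> z \<otimes> inv (x [^] n)) \<in> R \<or>
        r \<otimes> (x [^] n \<otimes> z \<otimes> inv (x [^] n)) \<in> ?Z \<and> 0 < n"
      using rn RZ Z.m_closed by blast
    moreover have "(r \<otimes> x [^] n) \<otimes> z = r \<otimes> (x [^] n \<otimes> z \<otimes> inv (x [^] n)) \<otimes> x [^] n"
      using r z by (simp add: word_simps)
    ultimately show ?thesis unfolding S_def by blast
  qed
  have S_disj: "r \<otimes> x [^] n \<notin> ?Z" if rn: "r \<in> R \<or> r \<in> ?Z \<and> 0 < n" for r and n :: nat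
  proof
    assume z: "r \<otimes> x [^] n \<in> ?Z"
    have r: "r \<in> carrier G" using that R_carr by auto
    show False
    proof (cases "r \<in> ?Z")
      case True
      then have "inv r \<otimes> (r \<otimes> x [^] n) \<in> ?Z" using z by blast
      then show False using nz True rn RZ_disj r by (auto simp: word_simps)
    next
      case False
      then have rR: "r \<in> R" using rn by blast
      have "inv (r \<otimes> x [^] n) \<otimes> r \<in> R" using z rR ZR by blast
      then have "inv (x [^] n) \<in> R" using r by (simp add: word_simps)
      moreover have "n \<noteq> 0" using z RZ_disj[OF rR] r by (intro notI) simp
      ultimately show False using nr by blast
    qed
  qed
  show "relative_cone i S"
    unfolding relative_cone_def
  proof (intro conjI ballI)
    show "S \<subseteq> carrier G" using SZ by auto
    show "S \<inter> ?Z = {}" using S_disj by (auto simp: S_def)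
  next
    fix r s assume "r \<in> S" "s \<in> S"
    then show "r \<otimes> s \<in> S" using S_mult unfolding S_def by blast
  next
    fix r z assume "r \<in> S" "z \<in> ?Z"
    then show "r \<otimes> z \<in> S" using S_Z unfolding S_def by blast
  qed
qed

text \<open>A maximal cone is total. If neither \<open>x\<close> nor \<open>x^-1\<close> could be
  adjoined to it, it would contain \<open>x^-n\<close> and \<open>x^m\<close> for some positive
  \<open>n\<close> and \<open>m\<close>, hence both \<open>x^(n m)\<close> and its inverse, hence
  the identity. Powers of \<open>x\<close> stay out of term \<open>i\<close> by torsion-freeness of
  the factors.\<close>

lemma ex_total_relative_cone:
  assumes "torsion_free_group G"
  shows "\<exists>R. relative_cone i R \<and> R \<subseteq> upper_central_series (Suc i) \<and>
    (\<forall>x\<in>upper_central_series (Suc i). x \<in> upper_central_series i \<or> x \<in> R \<or> inv x \<in> R)"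
proof -
  let ?Z = "upper_central_series i"
  interpret Z: normal ?Z G by (rule upper_central_normal)
  interpret Z': normal "upper_central_series (Suc i)" G by (rule upper_central_normal)
  let ?A = "{R. relative_cone i R \<and> R \<subseteq> upper_central_series (Suc i)}"
  have "\<exists>M\<in>?A. \<forall>X\<in>?A. M \<subseteq> X \<longrightarrow> X = M"
  proof (rule subset_Zorn_nonempty)
    have "{} \<in> ?A" by (auto simp: relative_cone_def)
    then show "?A \<noteq> {}" by blast
  next
    fix C assume C: "C \<noteq> {}" "subset.chain ?A C"
    then have CA: "C \<subseteq> ?A" and tot: "\<And>X Y. X \<in> C \<Longrightarrow> Y \<in> C \<Longrightarrow> X \<subseteq> Y \<or> Y \<subseteq> X"
      by (auto simp: subset_chain_def)
    have "r \<otimes> s \<in> \<Union>C" if *: "r \<in> X" "s \<in> Y" "X \<in> C" "Y \<in> C" for r s X Y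
    proof -
      obtain V where "V \<in> C" "r \<in> V" "s \<in> V" using tot[OF *(3,4)] * by blast
      moreover from this have "r \<otimes> s \<in> V" using CA unfolding relative_cone_def by blast
      ultimately show ?thesis by blast
    qed
    moreover have "\<Union>C \<subseteq> carrier G"
      and "\<forall>r\<in>\<Union>C. \<forall>z\<in>?Z. r \<otimes> z \<in> \<Union>C" and "\<Union>C \<inter> ?Z = {}"
      and "\<Union>C \<subseteq> upper_central_series (Suc i)"
      using CA unfolding relative_cone_def by blast+
    ultimately show "\<Union>C \<in> ?A" unfolding relative_cone_def by blast
  qed
  then obtain R where R: "relative_cone i R" "R \<subseteq> upper_central_series (Suc i)"
    and mx: "\<And>X. relative_cone i X \<Longrightarrow> X \<subseteq> upper_central_series (Suc i) \<Longrightarrow> R \<subseteq> X \<Longrightarrow> X = R"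
    by auto
  have R_pow: "r [^] n \<in> R" if "r \<in> R" "0 < n" for r and n :: nat
    using that(2,1)
  proof (induction n rule: nat_induct_non_zero)
    case 1
    then show ?case using R by (auto simp: relative_cone_def)
  next
    case (Suc n)
    then show ?case using R by (auto simp: relative_cone_def)
  qed
  have key: "\<exists>n>0. inv (x [^] (n::nat)) \<in> R"
    if x: "x \<in> upper_central_series (Suc i)" "x \<notin> ?Z" "x \<notin> R" for x
  proof (rule ccontr)
    assume n: "\<not> ?thesis"
    have nz: "x [^] n \<notin> ?Z" if "0 < n" for n :: nat
      using upper_central_factor_torsion_free[OF assms] x that by blast
    show False
      using relative_cone_adjoin[OF R x(1) nz] mx n x(3) by blast
  qed
  have "x \<in> R \<or> inv x \<in> R" if x: "x \<in> upper_central_series (Suc i)" "x \<notin> ?Z" for x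
  proof (rule ccontr)
    assume "\<not> ?thesis"
    then have xR: "x \<notin> R" "inv x \<notin> R" by auto
    have xc: "x \<in> carrier G" using x by auto
    obtain n where n: "0 < n" "inv (x [^] (n::nat)) \<in> R" using key x xR by blast
    have "inv x \<notin> ?Z" using x xc Z.m_inv_closed by (metis inv_inv)
    then obtain m where m: "0 < m" "inv (inv x [^] (m::nat)) \<in> R"
      using key[of "inv x"] x xR by blast
    have "inv (inv x [^] m) = x [^] m" using xc by (simp add: nat_pow_inv)
    with m have m': "x [^] m \<in> R" by simp
    have 1: "x [^] (n * m) \<in> R" using R_pow[OF m' n(1)] xc by (simp add: nat_pow_pow mult.commute)
    have 2: "inv (x [^] (n * m)) \<in> R"
      using R_pow[OF n(2) m(1)] xc by (simp add: nat_pow_inv nat_pow_pow)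
    have "x [^] (n * m) \<otimes> inv (x [^] (n * m)) \<in> R"
      using 1 2 R unfolding relative_cone_def by blast
    then have "\<one> \<in> R" using xc by simp
    then show False using R by (auto simp: relative_cone_def)
  qed
  then show ?thesis using R by blast
qed

text \<open>The sign of an element is decided lexicographically, by the factor of the upper central
  series in which it is first visible. The union of a cone relative to term \<open>j + 1\<close>
  with one inside term \<open>j + 1\<close> relative to term \<open>j\<close> is again a cone,
  because the former absorbs the latter.\<close>

lemma torsion_free_nilpotent_positive_cone:
  assumes "torsion_free_group G" "nilpotent_group G"
  shows "\<exists>P\<subseteq>carrier G. (\<forall>r\<in>P. \<forall>s\<in>P. r \<otimes> s \<in> P) \<and> \<one> \<notin> P \<and>
    (\<forall>x\<in>carrier G. x = \<one> \<or> x \<in> P \<or> inv x \<in> P)"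
proof -
  obtain n where n: "upper_central_series n = carrier G"
    using upper_central_eventually_carrier[OF assms(2)] by blast
  \<comment> \<open>The induction descends from term \<open>n\<close>, which is the whole group and
    has the empty cone, to the trivial term \<open>0\<close>.\<close>
  have "\<exists>P. relative_cone (n - i) P \<and>
      (\<forall>x\<in>carrier G. x \<in> upper_central_series (n - i) \<or> x \<in> P \<or> inv x \<in> P)"
    if "i \<le> n" for i
    using that
  proof (induction i)
    case 0
    then show ?case using n by (intro exI[of _ "{}"]) (auto simp: relative_cone_def)
  next
    case (Suc i)
    let ?j = "n - Suc i"
    have j: "n - i = Suc ?j" using Suc by simp
    interpret Z: normal "upper_central_series ?j" G by (rule upper_central_normal)
    interpret Z': normal "upper_central_series (Suc ?j)" G by (rule upper_central_normal)
    obtain P where P: "relative_cone (Suc ?j) P"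
      and Pt: "\<forall>x\<in>carrier G. x \<in> upper_central_series (Suc ?j) \<or> x \<in> P \<or> inv x \<in> P"
      using Suc j by auto
    obtain R where R: "relative_cone ?j R" "R \<subseteq> upper_central_series (Suc ?j)"
      and Rt: "\<forall>x\<in>upper_central_series (Suc ?j). x \<in> upper_central_series ?j \<or> x \<in> R \<or> inv x \<in> R"
      using ex_total_relative_cone[OF assms(1)] by blast
    have PP: "\<And>r s. r \<in> P \<Longrightarrow> s \<in> P \<Longrightarrow> r \<otimes> s \<in> P"
      and PZ: "\<And>r s. r \<in> P \<Longrightarrow> s \<in> upper_central_series (Suc ?j) \<Longrightarrow> r \<otimes> s \<in> P"
      using P unfolding relative_cone_def by blast+
    have RR: "\<And>r s. r \<in> R \<Longrightarrow> s \<in> R \<Longrightarrow> r \<otimes> s \<in> R"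
      and RZ: "\<And>r s. r \<in> R \<Longrightarrow> s \<in> upper_central_series ?j \<Longrightarrow> r \<otimes> s \<in> R"
      using R(1) unfolding relative_cone_def by blast+
    have "relative_cone ?j (P \<union> R)"
      unfolding relative_cone_def
    proof (intro conjI ballI)
      show "P \<union> R \<subseteq> carrier G" using P R by (auto simp: relative_cone_def)
      show "(P \<union> R) \<inter> upper_central_series ?j = {}"
        using P R upper_central_mono[of ?j] by (auto simp: relative_cone_def)
    next
      fix r s assume "r \<in> P \<union> R" "s \<in> P \<union> R"
      then show "r \<otimes> s \<in> P \<union> R"
        using PP PZ RR relative_cone_mult_left[OF P] R(2) by (elim UnE) blast+
    next
      fix r z assume "r \<in> P \<union> R" "z \<in> upper_central_series ?j"
      then show "r \<otimes> z \<in> P \<union> R"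
        using PZ RZ upper_central_mono[of ?j] by blast
    qed
    then show ?case using Pt Rt by blast
  qed
  from this[of n] obtain P where "relative_cone 0 P"
    "\<forall>x\<in>carrier G. x \<in> upper_central_series 0 \<or> x \<in> P \<or> inv x \<in> P"
    by auto
  then show ?thesis by (intro exI[of _ P]) (auto simp: relative_cone_def)
qed

end

section \<open>Polynomial growth of nilpotent groups\<close>

text \<open>The identity is allowed as a letter, so these are the words of length at most
  \<open>n\<close> and the balls increase.\<close>

primrec word_ball :: "('a, 'c) monoid_scheme \<Rightarrow> 'a set \<Rightarrow> nat \<Rightarrow> 'a set" where
  "word_ball G X 0 = {\<one>\<^bsub>G\<^esub>}"
| "word_ball G X (Suc n) = (\<lambda>(x, w). x \<otimes>\<^bsub>G\<^esub> w) ` (insert \<one>\<^bsub>G\<^esub> X \<times> word_ball G X n)"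

context group
begin

lemma word_ball_closed: "X \<subseteq> carrier G \<Longrightarrow> word_ball G X n \<subseteq> carrier G"
  by (induction n) auto

lemma word_ball_finite: "finite X \<Longrightarrow> finite (word_ball G X n)"
  by (induction n) auto

lemma word_ball_SucI:
  "x \<in> X \<Longrightarrow> w \<in> word_ball G X n \<Longrightarrow> x \<otimes> w \<in> word_ball G X (Suc n)"
  by force

lemma word_ball_Suc_mono: "X \<subseteq> carrier G \<Longrightarrow> word_ball G X n \<subseteq> word_ball G X (Suc n)"
  using word_ball_closed[of X n] by (force simp: image_iff)

lemma word_ball_mono: "X \<subseteq> carrier G \<Longrightarrow> m \<le> n \<Longrightarrow> word_ball G X m \<subseteq> word_ball G X n"
  by (rule lift_Suc_mono_le[of "word_ball G X"]) (auto dest: word_ball_Suc_mono simp del: word_ball.simps)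

lemma word_ball_one: "X \<subseteq> carrier G \<Longrightarrow> \<one> \<in> word_ball G X n"
  using word_ball_mono[of X 0 n] by auto

lemma word_ball_incl: "X \<subseteq> carrier G \<Longrightarrow> x \<in> X \<Longrightarrow> 0 < n \<Longrightarrow> x \<in> word_ball G X n"
  using word_ball_SucI[of x X \<one> 0] word_ball_mono[of X "Suc 0" n]
  by (auto simp: subset_iff simp del: word_ball.simps(2))

lemma word_ball_mult:
  assumes X: "X \<subseteq> carrier G" and "a \<in> word_ball G X m" "b \<in> word_ball G X n"
  shows "a \<otimes> b \<in> word_ball G X (m + n)"
  using assms(2)
proof (induction m arbitrary: a)
  case 0
  then show ?case using assms word_ball_closed[OF X, of n] by auto
next
  case (Suc m)
  then obtain x w where xw: "x \<in> insert \<one> X" "w \<in> word_ball G X m" "a = x \<otimes> w" by auto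
  have b: "b \<in> carrier G" "w \<in> carrier G" "x \<in> carrier G"
    using assms xw word_ball_closed[OF X] by auto
  have "x \<otimes> (w \<otimes> b) \<in> word_ball G X (Suc (m + n))"
    using xw Suc.IH[OF xw(2)] by auto
  then show ?case using b xw by (simp add: m_assoc del: word_ball.simps)
qed

lemma word_ball_inv:
  assumes X: "X \<subseteq> carrier G" and sym: "\<And>x. x \<in> X \<Longrightarrow> inv x \<in> X"
  shows "a \<in> word_ball G X n \<Longrightarrow> inv a \<in> word_ball G X n"
proof (induction n arbitrary: a)
  case (Suc n)
  then obtain x w where xw: "x \<in> insert \<one> X" "w \<in> word_ball G X n" "a = x \<otimes> w" by auto
  have c: "w \<in> carrier G" "x \<in> carrier G" using xw word_ball_closed[OF X] X by auto
  have "inv x \<in> word_ball G X 1"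
    using xw sym word_ball_incl[OF X, of _ 1] word_ball_one[OF X, of 1]
    by (cases "x = \<one>") (auto simp del: word_ball.simps(2))
  then have "inv w \<otimes> inv x \<in> word_ball G X (n + 1)"
    using word_ball_mult[OF X Suc.IH[OF xw(2)]] by blast
  then show ?case using xw c by (simp add: inv_mult_group)
qed simp

lemma generate_eq_word_balls:
  assumes X: "X \<subseteq> carrier G" and sym: "\<And>x. x \<in> X \<Longrightarrow> inv x \<in> X"
  shows "generate G X = (\<Union>n. word_ball G X n)"
proof
  show "generate G X \<subseteq> (\<Union>n. word_ball G X n)"
  proof
    fix a assume "a \<in> generate G X"
    then show "a \<in> (\<Union>n. word_ball G X n)"
    proof induction
      case one
      then show ?case using word_ball_one[OF X] by blast
    next
      case (incl h)
      show ?case using word_ball_incl[OF X incl zero_less_one] by (rule UN_I[OF UNIV_I])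
    next
      case (inv h)
      show ?case using word_ball_incl[OF X sym[OF inv] zero_less_one] by (rule UN_I[OF UNIV_I])
    next
      case (eng h1 h2)
      then show ?case using word_ball_mult[OF X] by blast
    qed
  qed
  have "word_ball G X n \<subseteq> generate G X" for n
  proof (induction n)
    case 0
    then show ?case by (simp add: generate.one)
  next
    case (Suc n)
    have "insert \<one> X \<subseteq> generate G X" by (simp add: generate.one generate.incl subset_iff)
    then have "x \<otimes> w \<in> generate G X" if "x \<in> insert \<one> X" "w \<in> word_ball G X n" for x w
      using that Suc by (intro generate.eng) blast+
    then show ?case by auto
  qed
  then show "(\<Union>n. word_ball G X n) \<subseteq> generate G X" by blast
qed

lemma lower_central_m_inv_closed:
  "h \<in> lower_central_series G n \<Longrightarrow> inv h \<in> lower_central_series G n"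
proof (cases n)
  case (Suc m)
  have "subgroup (lower_central_series G (Suc m)) G"
    unfolding lower_central_series.simps
    by (rule generate_is_subgroup) (use lower_central_closed[of m] in auto)
  then show "h \<in> lower_central_series G n \<Longrightarrow> ?thesis"
    using Suc by (auto intro: subgroup.m_inv_closed)
qed simp

lemma lower_central_commutator':
  assumes "h \<in> lower_central_series G n" "g \<in> carrier G"
  shows "g \<otimes> h \<otimes> inv g \<otimes> inv h \<in> lower_central_series G (Suc n)"
proof -
  have "h \<in> carrier G" using assms lower_central_closed by blast
  then have "inv (h \<otimes> g \<otimes> inv h \<otimes> inv g) = g \<otimes> h \<otimes> inv g \<otimes> inv h"
    using assms by (simp add: word_simps)
  then show ?thesis using lower_central_m_inv_closed[OF lower_central_commutator[OF assms]] by simp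
qed

section \<open>Finite sets closed under commutators\<close>

primrec commutator_closure :: "'a set \<Rightarrow> nat \<Rightarrow> 'a set" where
  "commutator_closure S 0 = insert \<one> (S \<union> m_inv G ` S)"
| "commutator_closure S (Suc k) = commutator_closure S k \<union>
     (\<lambda>(a, b). a \<otimes> b \<otimes> inv a \<otimes> inv b) ` (commutator_closure S k \<times> commutator_closure S k)"

lemma finite_commutator_closure: "finite S \<Longrightarrow> finite (commutator_closure S k)"
  by (induction k) auto

lemma commutator_closure_generate:
  assumes "S \<subseteq> carrier G"
  shows "commutator_closure S k \<subseteq> generate G S"
proof -
  interpret H: subgroup "generate G S" G using assms by (rule generate_is_subgroup)
  show ?thesis
    by (induction k) (auto intro: generate.intros)
qed

lemma commutator_closure_closed: "S \<subseteq> carrier G \<Longrightarrow> commutator_closure S k \<subseteq> carrier G"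
  using commutator_closure_generate generate_incl by blast

lemma commutator_closure_inv:
  assumes S: "S \<subseteq> carrier G" and "a \<in> commutator_closure S k"
  shows "inv a \<in> commutator_closure S k"
  using assms(2)
proof (induction k arbitrary: a)
  case 0
  then show ?case using S by auto
next
  case (Suc k)
  show ?case
  proof (cases "a \<in> commutator_closure S k")
    case True
    then show ?thesis using Suc.IH by simp
  next
    case False
    then obtain b c where bc: "b \<in> commutator_closure S k" "c \<in> commutator_closure S k"
      "a = b \<otimes> c \<otimes> inv b \<otimes> inv c" using Suc.prems by auto
    then have "inv a = c \<otimes> b \<otimes> inv c \<otimes> inv b"
      using commutator_closure_closed[OF S, of k] by (auto simp: word_simps subset_iff)
    then show ?thesis using bc by force
  qed
qed

text \<open>A commutator formed at some stage either has both entries from an earlier stage, and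
  then is already present, or has an entry that was itself new and so lies one term deeper. In a
  nilpotent group the closure therefore stabilizes.\<close>

lemma commutator_closure_Suc_subset:
  assumes S: "S \<subseteq> carrier G"
  shows "commutator_closure S (Suc k) \<subseteq> commutator_closure S k \<union> lower_central_series G (Suc k)"
proof (induction k)
  case 0
  have "b \<otimes> c \<otimes> inv b \<otimes> inv c \<in> lower_central_series G (Suc 0)"
    if "b \<in> commutator_closure S 0" "c \<in> commutator_closure S 0" for b c
    using that commutator_closure_closed[OF S, of 0]
    by (intro lower_central_commutator) auto
  then show ?case by auto
next
  case (Suc k)
  have "b \<otimes> c \<otimes> inv b \<otimes> inv c \<in>
      commutator_closure S (Suc k) \<union> lower_central_series G (Suc (Suc k))"
    if b: "b \<in> commutator_closure S (Suc k)" and c: "c \<in> commutator_closure S (Suc k)" for b c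
  proof -
    have bc: "b \<in> carrier G" "c \<in> carrier G" using b c commutator_closure_closed[OF S] by blast+
    consider "b \<in> lower_central_series G (Suc k)" | "c \<in> lower_central_series G (Suc k)"
      | "b \<in> commutator_closure S k" "c \<in> commutator_closure S k"
      using Suc b c by blast
    then show ?thesis
    proof cases
      case 1
      then show ?thesis using lower_central_commutator bc by blast
    next
      case 2
      then show ?thesis using lower_central_commutator' bc by blast
    next
      case 3
      then show ?thesis by force
    qed
  qed
  then have "(\<lambda>(a, b). a \<otimes> b \<otimes> inv a \<otimes> inv b) `
      (commutator_closure S (Suc k) \<times> commutator_closure S (Suc k))
      \<subseteq> commutator_closure S (Suc k) \<union> lower_central_series G (Suc (Suc k))"
    by (intro image_subsetI) (auto simp del: commutator_closure.simps)
  then show ?case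
    unfolding commutator_closure.simps(2)[of S "Suc k"] by (intro Un_least Un_upper1)
qed

text \<open>The growth estimate adds generators one at a time and needs their commutators among the
  generators already present. Enlarging \<open>S\<close> in this way does not change the generated
  subgroup.\<close>

lemma ex_finite_commutator_closed:
  assumes "nilpotent_group G" "finite S" and S: "S \<subseteq> carrier G"
  shows "\<exists>X. finite X \<and> S \<subseteq> X \<and> X \<subseteq> generate G S \<and> \<one> \<in> X \<and> (\<forall>x\<in>X. inv x \<in> X) \<and>
    (\<forall>a\<in>X. \<forall>b\<in>X. a \<otimes> b \<otimes> inv a \<otimes> inv b \<in> X)"
proof -
  obtain c where c: "lower_central_series G c = {\<one>}"
    using assms by (auto simp: nilpotent_group_def)
  \<comment> \<open>The inclusion for stage \<open>c\<close> mentions term \<open>c + 1\<close>, so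
    the series must be seen to stay trivial one step beyond \<open>c\<close>.\<close>
  have "(\<Union>h\<in>lower_central_series G c. \<Union>g\<in>carrier G. {h \<otimes> g \<otimes> inv h \<otimes> inv g}) = {\<one>}"
    using one_closed unfolding c by force
  then have c1: "lower_central_series G (Suc c) = {\<one>}"
    by (simp add: lower_central_series.simps(2) generate_one)
  have mono: "commutator_closure S 0 \<subseteq> commutator_closure S k" for k
    by (rule lift_Suc_mono_le) auto
  then have one: "\<one> \<in> commutator_closure S k" for k by (auto simp: subset_iff)
  have *: "a \<otimes> b \<otimes> inv a \<otimes> inv b \<in> commutator_closure S (Suc c)"
    if "a \<in> commutator_closure S c" "b \<in> commutator_closure S c" for a b
    using that by auto
  have "a \<otimes> b \<otimes> inv a \<otimes> inv b \<in> commutator_closure S c"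
    if "a \<in> commutator_closure S c" "b \<in> commutator_closure S c" for a b
    using subsetD[OF commutator_closure_Suc_subset[OF S] *[OF that]] one[of c] unfolding c1
    by (elim UnE singletonE) simp_all
  moreover have "S \<subseteq> commutator_closure S c" using mono[of c] by auto
  ultimately show ?thesis
    using finite_commutator_closure[OF assms(2), of c] commutator_closure_generate[OF S, of c]
      commutator_closure_inv[OF S] one[of c]
    by (intro exI[of _ "commutator_closure S c"] conjI ballI)
qed

section \<open>Growth of balls when generators are added\<close>

definition polynomial_growth :: "'a set \<Rightarrow> bool" where
  "polynomial_growth Y \<longleftrightarrow> (\<exists>C d. \<forall>n. card (word_ball G Y n) \<le> C * (n + 1) ^ d)"

text \<open>Conjugating \<open>y\<close> by \<open>x\<close> multiplies it by a commutator that lies deeper in the lower central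
  series, so by a Pascal type recursion the length of a conjugate by \<open>x\<^sup>k\<close> is polynomial in \<open>k\<close>.\<close>

lemma conjugate_pow_in_word_ball:
  assumes c: "lower_central_series G c = {\<one>}"
    and Y: "Y \<subseteq> carrier G" and x: "x \<in> carrier G"
    and comm: "\<And>y. y \<in> Y \<Longrightarrow> inv y \<otimes> inv x \<otimes> y \<otimes> x \<in> Y"
  shows "m \<le> c \<Longrightarrow> y \<in> Y \<Longrightarrow> y \<in> lower_central_series G (c - m) \<Longrightarrow>
    inv (x [^] k) \<otimes> y \<otimes> x [^] (k::nat) \<in> word_ball G Y ((k + 1) ^ m)"
proof (induction m arbitrary: y k)
  case 0
  then show ?case using c x word_ball_one[OF Y] by simp
next
  case (Suc m)
  have y: "y \<in> carrier G" using Suc Y by auto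
  define y' where "y' = inv y \<otimes> inv x \<otimes> y \<otimes> x"
  have "inv y \<otimes> inv x \<otimes> inv (inv y) \<otimes> inv (inv x) \<in> lower_central_series G (Suc (c - Suc m))"
    using Suc.prems x by (intro lower_central_commutator lower_central_m_inv_closed) auto
  moreover have "Suc (c - Suc m) = c - m" using Suc.prems by simp
  ultimately have y': "y' \<in> lower_central_series G (c - m)" "y' \<in> Y" "y' \<in> carrier G"
    using x y comm[OF Suc.prems(2)] by (auto simp: y'_def)
  have IH: "inv (x [^] k) \<otimes> y' \<otimes> x [^] k \<in> word_ball G Y ((k + 1) ^ m)" for k
    using Suc.IH y' Suc.prems by simp
  show ?case
  proof (induction k)
    case 0
    then show ?case using y word_ball_incl[OF Y \<open>y \<in> Y\<close>, of 1] by simp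
  next
    case (Suc k)
    have "(k + 1) ^ Suc m + (k + 1) ^ m = (k + 1) ^ m * (k + 2)" by (simp add: algebra_simps)
    also have "\<dots> \<le> (k + 2) ^ m * (k + 2)" by (intro mult_right_mono power_mono) auto
    finally have le: "(k + 1) ^ Suc m + (k + 1) ^ m \<le> (Suc k + 1) ^ Suc m" by (simp add: mult.commute)
    have "inv (x [^] Suc k) \<otimes> y \<otimes> x [^] Suc k
      = (inv (x [^] k) \<otimes> y \<otimes> x [^] k) \<otimes> (inv (x [^] k) \<otimes> y' \<otimes> x [^] k)"
      unfolding y'_def nat_pow_Suc2[OF x] using x y by (simp add: word_simps)
    then show ?case
      using word_ball_mult[OF Y Suc IH[of k]] word_ball_mono[OF Y le] by auto
  qed
qed

text \<open>Collecting all letters \<open>x\<close> and \<open>x^-1\<close> of a word at the front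
  conjugates the other letters by powers of \<open>x\<close>, which lengthens them only
  polynomially. A word of length \<open>n\<close> becomes \<open>x^e v\<close> with \<open>e\<close>
  between \<open>-n\<close> and \<open>n\<close> and \<open>v\<close> in a ball of polynomial radius
  over \<open>Y\<close>.\<close>

lemma polynomial_growth_adjoin:
  assumes c: "lower_central_series G c = {\<one>}" and fin: "finite Y"
    and Y: "Y \<subseteq> carrier G" "\<one> \<in> Y" and x: "x \<in> carrier G"
    and comm: "\<And>y. y \<in> Y \<Longrightarrow> inv y \<otimes> inv x \<otimes> y \<otimes> x \<in> Y"
      "\<And>y. y \<in> Y \<Longrightarrow> inv y \<otimes> x \<otimes> y \<otimes> inv x \<in> Y"
    and "polynomial_growth Y"
  shows "polynomial_growth (insert x (insert (inv x) Y))"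
proof -
  obtain C d where C: "\<And>n. card (word_ball G Y n) \<le> C * (n + 1) ^ d"
    using assms(8) unfolding polynomial_growth_def by blast
  let ?Y = "insert x (insert (inv x) Y)"
  have conj: "x [^] (- e) \<otimes> y \<otimes> x [^] e \<in> word_ball G Y ((n + 1) ^ c)"
    if y: "y \<in> Y" and e: "\<bar>e\<bar> \<le> int n" for y n and e :: int
  proof -
    \<comment> \<open>The conjugation lemma is applied with \<open>m = c\<close>, where term
      \<open>c - m\<close> is the whole group.\<close>
    have yc: "y \<in> lower_central_series G (c - c)" using y Y by auto
    have "x [^] (- e) \<otimes> y \<otimes> x [^] e \<in> word_ball G Y ((nat \<bar>e\<bar> + 1) ^ c)"
    proof (cases "e \<ge> 0")
      case True
      then obtain k where "e = int k" using nonneg_int_cases by blast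
      then show ?thesis
        using conjugate_pow_in_word_ball[OF c Y(1) x comm(1) le_refl y yc, of k] x
        by (simp add: int_pow_int int_pow_neg)
    next
      case False
      then obtain k where k: "e = - int k" by (metis nonpos_int_cases linear)
      have ix: "inv x \<in> carrier G" using x by simp
      have "inv (inv x [^] k) \<otimes> y \<otimes> inv x [^] k \<in> word_ball G Y ((k + 1) ^ c)"
        by (rule conjugate_pow_in_word_ball[OF c Y(1) ix _ le_refl y yc]) (use comm x in auto)
      then show ?thesis
        using x k by (simp add: int_pow_int int_pow_neg nat_pow_inv)
    qed
    moreover have "(nat \<bar>e\<bar> + 1) ^ c \<le> (n + 1) ^ c" using e by (intro power_mono) auto
    ultimately show ?thesis using word_ball_mono[OF Y(1)] by blast
  qed
  have decomp: "\<exists>e::int. \<exists>v. \<bar>e\<bar> \<le> int n \<and> v \<in> word_ball G Y (n * (n + 1) ^ c) \<and> w = x [^] e \<otimes> v"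
    if "w \<in> word_ball G ?Y n" for w n
    using that
  proof (induction n arbitrary: w)
    case 0
    then show ?case by (intro exI[of _ 0]) auto
  next
    case (Suc n)
    then obtain a u where a: "a \<in> insert \<one> ?Y" and u: "u \<in> word_ball G ?Y n" and w: "w = a \<otimes> u"
      by auto
    obtain e v where e: "\<bar>e\<bar> \<le> int n" and v: "v \<in> word_ball G Y (n * (n + 1) ^ c)"
      and u': "u = x [^] e \<otimes> v" using Suc.IH[OF u] by blast
    have vc: "v \<in> carrier G" using v word_ball_closed[OF Y(1)] by blast
    have "(n + 1) ^ c + n * (n + 1) ^ c = Suc n * (n + 1) ^ c" by simp
    also have "\<dots> \<le> Suc n * (Suc n + 1) ^ c" by (intro mult_left_mono power_mono) auto
    finally have le: "(n + 1) ^ c + n * (n + 1) ^ c \<le> Suc n * (Suc n + 1) ^ c" .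
    then have v': "v \<in> word_ball G Y (Suc n * (Suc n + 1) ^ c)"
      using v word_ball_mono[OF Y(1), OF order.trans[OF le_add2 le]] by blast
    consider "a = x" | "a = inv x" | "a \<in> Y" using a Y by auto
    then show ?case
    proof cases
      case 1
      then have "w = x [^] (1 + e) \<otimes> v"
        using w u' x vc by (simp add: int_pow_mult m_assoc)
      then show ?thesis using e v' by (intro exI[of _ "1 + e"] exI[of _ v]) auto
    next
      case 2
      have "x [^] (- 1 + e) = inv x \<otimes> x [^] e"
        unfolding int_pow_mult[OF x] int_pow_neg[OF x] using x by simp
      then have "w = x [^] (- 1 + e) \<otimes> v"
        using 2 w u' x vc by (simp add: m_assoc)
      then show ?thesis using e v' by (intro exI[of _ "- 1 + e"] exI[of _ v]) auto
    next
      case 3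
      then have ac: "a \<in> carrier G" using Y by auto
      \<comment> \<open>Here \<open>a x^e v = x^e (x^-e a x^e) v\<close>, and the conjugate has
        length at most \<open>(n + 1)^c\<close>.\<close>
      have "x [^] (- e) \<otimes> a \<otimes> x [^] e \<otimes> v \<in> word_ball G Y (Suc n * (Suc n + 1) ^ c)"
        using word_ball_mult[OF Y(1) conj[OF 3 e] v] word_ball_mono[OF Y(1) le] by blast
      moreover have "w = x [^] e \<otimes> (x [^] (- e) \<otimes> a \<otimes> x [^] e \<otimes> v)"
        using w u' x vc ac by (simp add: int_pow_neg word_simps)
      ultimately show ?thesis using e by (intro exI[of _ e]) auto
    qed
  qed
  \<comment> \<open>There are \<open>2 n + 1\<close> exponents, at most \<open>2 (n + 1)\<close>,
    and \<open>n (n + 1)^c + 1\<close> is at most \<open>(n + 1)^(c + 1)\<close>.\<close>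
  have "card (word_ball G ?Y n) \<le> (2 * C) * (n + 1) ^ (1 + (c + 1) * d)" for n
  proof -
    let ?B = "word_ball G Y (n * (n + 1) ^ c)"
    have "word_ball G ?Y n \<subseteq> (\<lambda>(e, v). x [^] e \<otimes> v) ` ({- int n..int n} \<times> ?B)"
      using decomp[of _ n] by (force simp: abs_le_iff)
    then have "card (word_ball G ?Y n) \<le> card ({- int n..int n} \<times> ?B)"
      by (rule surj_card_le[rotated]) (use word_ball_finite[OF fin] in auto)
    also have "\<dots> = (2 * n + 1) * card ?B"
      unfolding card_cartesian_product card_atLeastAtMost_int by (rule arg_cong2[of _ _ _ _ "(*)"]) simp_all
    also have "\<dots> \<le> (2 * (n + 1)) * (C * (n * (n + 1) ^ c + 1) ^ d)"
      by (intro mult_mono C) auto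
    also have "\<dots> \<le> (2 * (n + 1)) * (C * ((n + 1) ^ (c + 1)) ^ d)"
      by (intro mult_left_mono power_mono) auto
    also have "\<dots> = (2 * C) * (n + 1) ^ (1 + (c + 1) * d)"
      unfolding power_mult[symmetric] power_add[of _ 1] power_one_right by (simp only: mult_ac)
    finally show ?thesis .
  qed
  then show ?thesis unfolding polynomial_growth_def by blast
qed

text \<open>The elements of \<open>X\<close> are added from the deepest term of the lower central
  series upwards. When an element of term \<open>j\<close> arrives, its commutators with members of
  \<open>X\<close> lie in \<open>X\<close> and in term \<open>j + 1\<close>, so they are already
  there.\<close>

lemma nilpotent_polynomial_growth:
  assumes nil: "nilpotent_group G" and fin: "finite X" and X: "X \<subseteq> carrier G" "\<one> \<in> X"
    and sym: "\<And>x. x \<in> X \<Longrightarrow> inv x \<in> X"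
    and comm: "\<And>a b. a \<in> X \<Longrightarrow> b \<in> X \<Longrightarrow> a \<otimes> b \<otimes> inv a \<otimes> inv b \<in> X"
  shows "polynomial_growth X"
proof -
  obtain c where c: "lower_central_series G c = {\<one>}"
    using assms by (auto simp: nilpotent_group_def)
  \<comment> \<open>Taking the union over all deeper terms makes \<open>Y j\<close> grow as
    \<open>j\<close> decreases without an appeal to monotonicity of the series.\<close>
  define Y where "Y j = insert \<one> (X \<inter> (\<Union>i\<in>{j..c}. lower_central_series G i))" for j
  have Yc: "Y c = {\<one>}" using c X by (auto simp: Y_def)
  have "polynomial_growth (Y (c - i))" if "i \<le> c" for i
    using that
  proof (induction i)
    case 0
    have "word_ball G {\<one>} n = {\<one>}" for n by (induction n) auto
    then show ?case unfolding polynomial_growth_def Yc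
      by (intro exI[of _ 1] exI[of _ 0]) (auto simp: Yc)
  next
    case (Suc i)
    define j where "j = c - Suc i"
    have j: "c - i = Suc j" "j < c" using Suc by (auto simp: j_def)
    have adj: "polynomial_growth (Y (Suc j) \<union> F \<union> m_inv G ` F)"
      if "finite F" "F \<subseteq> X \<inter> lower_central_series G j" for F
      using that
    proof (induction F)
      case empty
      then show ?case using Suc j by simp
    next
      case (insert x F)
      let ?Y = "Y (Suc j) \<union> F \<union> m_inv G ` F"
      have x: "x \<in> X" "x \<in> lower_central_series G j" "x \<in> carrier G" using insert X by auto
      have YX: "?Y \<subseteq> X" using insert.prems sym X by (auto simp: Y_def)
      have step: "inv y \<otimes> inv z \<otimes> y \<otimes> z \<in> ?Y"
        if y: "y \<in> ?Y" and z: "z \<in> X" "z \<in> lower_central_series G j" for y z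
      proof -
        have yX: "y \<in> X" using YX y by blast
        have yz: "y \<in> carrier G" "z \<in> carrier G" using yX z X by auto
        have "inv y \<otimes> inv z \<otimes> inv (inv y) \<otimes> inv (inv z) \<in> lower_central_series G (Suc j)"
          using yz z by (intro lower_central_commutator' lower_central_m_inv_closed) auto
        moreover have "inv y \<otimes> inv z \<otimes> inv (inv y) \<otimes> inv (inv z) \<in> X"
          using sym yX z by (intro comm) auto
        ultimately show ?thesis using yz j by (auto simp: Y_def)
      qed
      have "polynomial_growth (insert x (insert (inv x) ?Y))"
      proof (rule polynomial_growth_adjoin[OF c])
        show "finite ?Y" using insert fin by (auto simp: Y_def)
        show "?Y \<subseteq> carrier G" using YX X by blast
        show "\<one> \<in> ?Y" by (auto simp: Y_def)
        show "x \<in> carrier G" by fact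
        show "polynomial_growth ?Y" using insert by auto
        show "inv y \<otimes> inv x \<otimes> y \<otimes> x \<in> ?Y" if "y \<in> ?Y" for y
          using step[OF that] x by blast
        show "inv y \<otimes> x \<otimes> y \<otimes> inv x \<in> ?Y" if "y \<in> ?Y" for y
          using step[OF that, of "inv x"] x sym lower_central_m_inv_closed by auto
      qed
      then show ?case by (simp add: Un_commute insert_commute)
    qed
    have "Y j = Y (Suc j) \<union> (X \<inter> lower_central_series G j) \<union> m_inv G ` (X \<inter> lower_central_series G j)"
    proof -
      have "{j..c} = insert j {Suc j..c}" using j by auto
      moreover have "m_inv G ` (X \<inter> lower_central_series G j) \<subseteq> X \<inter> lower_central_series G j"
        using sym lower_central_m_inv_closed by auto
      ultimately show ?thesis by (auto simp: Y_def)
    qed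
    then show ?case
      using adj[of "X \<inter> lower_central_series G j"] fin by (simp add: j_def)
  qed
  from this[of c] have "polynomial_growth (Y 0)" by simp
  moreover have "Y 0 = X"
  proof
    show "Y 0 \<subseteq> X" using X by (auto simp: Y_def)
    show "X \<subseteq> Y 0"
    proof
      fix x assume "x \<in> X"
      moreover from this have "x \<in> lower_central_series G 0" using X by auto
      ultimately show "x \<in> Y 0" unfolding Y_def by (intro insertI2 IntI UN_I[of 0]) auto
    qed
  qed
  ultimately show ?thesis by simp
qed

end

section \<open>Almost invariant weights\<close>

lemma power_ratio_near_one:
  fixes m :: real and p :: nat
  assumes "0 < e" "0 \<le> m"
  shows "\<exists>M\<ge>1. \<forall>x\<ge>M. \<forall>y. \<bar>y - x\<bar> \<le> m \<longrightarrow> \<bar>(x / y) ^ p - 1\<bar> \<le> e"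
proof -
  have "isCont (\<lambda>u::real. u ^ p) 1" by simp
  then obtain d where d: "0 < d" "\<And>u::real. \<bar>u - 1\<bar> < d \<Longrightarrow> \<bar>u ^ p - 1\<bar> < e"
    using assms(1) unfolding continuous_at_eps_delta dist_real_def by (metis power_one)
  \<comment> \<open>For \<open>x >= M\<close> the summand \<open>m\<close> gives
    \<open>y >= m / d + 1\<close>, so \<open>m / y < d\<close>.\<close>
  define M where "M = m + m / d + 1"
  have "\<bar>(x / y) ^ p - 1\<bar> \<le> e" if x: "x \<ge> M" and y: "\<bar>y - x\<bar> \<le> m" for x y
  proof -
    have "m / d < y" "0 \<le> m / d" using x y assms d by (auto simp: M_def)
    then have y0: "0 < y" by linarith
    have md: "m < d * y" using \<open>m / d < y\<close> d by (simp add: field_simps)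
    have "\<bar>x / y - 1\<bar> = \<bar>y - x\<bar> / y" using y0 by (simp add: field_simps abs_minus_commute)
    also have "\<dots> < d" using y md y0 by (simp add: field_simps)
    finally show ?thesis using d(2) by (meson less_imp_le)
  qed
  moreover have "M \<ge> 1" using assms d by (simp add: M_def)
  ultimately show ?thesis by blast
qed

context group
begin

lemma nilpotent_almost_invariant_weight:
  assumes nil: "nilpotent_group G" and "finite S" and S: "S \<subseteq> carrier G"
    and T: "finite T" "T \<subseteq> generate G S" and "0 < e"
  shows "\<exists>l::'a \<Rightarrow> real. (\<forall>h. 0 < l h) \<and> l summable_on generate G S \<and>
    (\<forall>t\<in>T. \<forall>h\<in>generate G S. \<bar>l (t \<otimes> h) / l h - 1\<bar> \<le> e) \<and>
    (\<forall>t\<in>generate G S. \<forall>\<delta>>0. finite {h \<in> generate G S. \<delta> < \<bar>l (t \<otimes> h) / l h - 1\<bar>})"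
proof -
  let ?H = "generate G S"
  obtain X where X: "finite X" "S \<subseteq> X" "X \<subseteq> ?H" "\<one> \<in> X" "\<And>x. x \<in> X \<Longrightarrow> inv x \<in> X"
    "\<And>a b. a \<in> X \<Longrightarrow> b \<in> X \<Longrightarrow> a \<otimes> b \<otimes> inv a \<otimes> inv b \<in> X"
    using ex_finite_commutator_closed[OF nil assms(2) S] by blast
  have H: "subgroup ?H G" "?H \<subseteq> carrier G"
    using S generate_is_subgroup generate_incl by blast+
  have Xc: "X \<subseteq> carrier G" using X H by blast
  have "generate G X \<subseteq> ?H" using generate_subgroup_incl[OF X(3) H(1)] .
  then have HW: "?H = (\<Union>n. word_ball G X n)"
    using mono_generate[OF X(2)] generate_eq_word_balls[OF Xc X(5)] by auto
  obtain C d where Cd: "\<And>n. card (word_ball G X n) \<le> C * (n + 1) ^ d"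
    using nilpotent_polynomial_growth[OF nil X(1) Xc X(4-6)] unfolding polynomial_growth_def by blast
  \<comment> \<open>Outside \<open>?H\<close> the value of \<open>len\<close> is unspecified;
    \<open>l\<close> is positive there all the same.\<close>
  define len where "len h = (LEAST n. h \<in> word_ball G X n)" for h
  have len: "h \<in> word_ball G X (len h)" if "h \<in> ?H" for h
    using that unfolding HW len_def by (auto intro: LeastI_ex)
  have len_le: "len h \<le> n" if "h \<in> word_ball G X n" for h n
    using that unfolding len_def by (rule Least_le)
  have len_mult: "len (t \<otimes> h) \<le> len t + len h" if "t \<in> ?H" "h \<in> ?H" for t h
    using that by (intro len_le word_ball_mult[OF Xc] len)
  \<comment> \<open>The other half of the bound comes from \<open>h = t^-1 (t h)\<close>, where
    \<open>t^-1\<close> is no longer than \<open>t\<close> because \<open>X\<close> is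
    symmetric.\<close>
  have len_diff: "\<bar>real (len (t \<otimes> h)) - real (len h)\<bar> \<le> real (len t)" if t: "t \<in> ?H" and h: "h \<in> ?H" for t h
  proof -
    have it: "inv t \<in> ?H" by (rule subgroup.m_inv_closed[OF H(1) t])
    have "len (inv t) \<le> len t"
      using word_ball_inv[OF Xc X(5) len[OF t]] by (rule len_le)
    moreover have "inv t \<otimes> (t \<otimes> h) = h"
      by (intro inv_cancel_left subsetD[OF H(2)] t h)
    moreover have "t \<otimes> h \<in> ?H" by (rule subgroup.m_closed[OF H(1) t h])
    ultimately show ?thesis
      using len_mult[OF t h] len_mult[OF it, of "t \<otimes> h"] by simp
  qed
  \<comment> \<open>At most \<open>C (n + 1)^d\<close> elements have length \<open>n\<close>, each
    of weight at most \<open>1 / (n + 1)^p\<close>; two extra powers leave the convergent series of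
    \<open>C / (n + 1)^2\<close>.\<close>
  define p where "p = d + 2"
  define m where "m = real (Max (insert 0 (len ` T)))"
  have m: "real (len t) \<le> m" if "t \<in> T" for t
    using that T unfolding m_def by (simp add: Max_ge)
  have "0 \<le> m" unfolding m_def by simp
  \<comment> \<open>Adding \<open>K\<close> to every length pushes all arguments into the range
    where a change by at most \<open>m\<close> moves the power ratio by at most
    \<open>e\<close>.\<close>
  obtain K where K: "K \<ge> 1" "\<And>x y. x \<ge> K \<Longrightarrow> \<bar>y - x\<bar> \<le> m \<Longrightarrow> \<bar>(x / y) ^ p - 1\<bar> \<le> e"
    using power_ratio_near_one[OF \<open>0 < e\<close> \<open>0 \<le> m\<close>] by metis
  define l where "l h = 1 / (K + real (len h)) ^ p" for h
  have l_ratio: "l a / l b = ((K + real (len b)) / (K + real (len a))) ^ p" for a b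
    by (simp add: l_def power_divide)
  have l_pos: "0 < l h" for h using K by (simp add: l_def add_pos_nonneg)
  have near: "\<bar>l (t \<otimes> h) / l h - 1\<bar> \<le> e" if "t \<in> T" "h \<in> ?H" for t h
    unfolding l_ratio
  proof (rule K(2))
    have "t \<in> ?H" using that T by blast
    then show "\<bar>K + real (len (t \<otimes> h)) - (K + real (len h))\<bar> \<le> m"
      using len_diff[of t h] that m[of t] by simp
  qed simp
  have fin: "finite {h \<in> ?H. \<delta> < \<bar>l (t \<otimes> h) / l h - 1\<bar>}" if t: "t \<in> ?H" and "\<delta> > 0" for t \<delta>
  proof -
    obtain M where M: "\<And>x y. x \<ge> M \<Longrightarrow> \<bar>y - x\<bar> \<le> real (len t) \<Longrightarrow> \<bar>(x / y) ^ p - 1\<bar> \<le> \<delta>"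
      using power_ratio_near_one[OF \<open>0 < \<delta>\<close>, of "real (len t)" p] by auto
    have "{h \<in> ?H. \<delta> < \<bar>l (t \<otimes> h) / l h - 1\<bar>} \<subseteq> word_ball G X (nat \<lceil>M\<rceil>)"
    proof safe
      fix h assume h: "h \<in> ?H" and "\<delta> < \<bar>l (t \<otimes> h) / l h - 1\<bar>"
      then have "\<not> M \<le> K + real (len h)"
        unfolding l_ratio using M[of "K + real (len h)" "K + real (len (t \<otimes> h))"] len_diff[OF t h]
        by auto
      then have "len h \<le> nat \<lceil>M\<rceil>" using K by linarith
      then show "h \<in> word_ball G X (nat \<lceil>M\<rceil>)" using len[OF h] word_ball_mono[OF Xc] by blast
    qed
    then show ?thesis using word_ball_finite[OF X(1)] finite_subset by blast
  qed
  have summ: "summable (\<lambda>n. real C * (1 / real (Suc n) ^ 2))"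
    using inverse_power_summable[of 2, where 'a = real] summable_Suc_iff[of "\<lambda>n. inverse (real n ^ 2)"]
    by (intro summable_mult) (simp add: inverse_eq_divide)
  have "l summable_on ?H"
  proof (rule nonneg_bdd_above_summable_on)
    show "0 \<le> l h" for h using l_pos by (simp add: less_imp_le)
    have "sum l F \<le> (\<Sum>n. real C * (1 / real (Suc n) ^ 2))" if F: "F \<subseteq> ?H" "finite F" for F
    proof -
      have "sum l F = (\<Sum>n\<in>len ` F. \<Sum>h | h \<in> F \<and> len h = n. l h)"
        using F by (simp add: sum.group)
      also have "\<dots> \<le> (\<Sum>n\<in>len ` F. real C * (1 / real (Suc n) ^ 2))"
      proof (rule sum_mono)
        fix n
        let ?B = "{h \<in> F. len h = n}"
        have "(\<Sum>h\<in>?B. l h) \<le> real (card ?B) * (1 / real (Suc n) ^ p)"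
        proof (rule sum_bounded_above)
          fix h assume "h \<in> ?B"
          then show "l h \<le> 1 / real (Suc n) ^ p"
            unfolding l_def using K by (intro divide_left_mono power_mono mult_pos_pos) auto
        qed
        also have "card ?B \<le> card (word_ball G X n)"
          using F len word_ball_finite[OF X(1)] by (intro card_mono) auto
        also have "\<dots> \<le> C * Suc n ^ d" using Cd[of n] by simp
        finally have "(\<Sum>h\<in>?B. l h) \<le> real (C * Suc n ^ d) * (1 / real (Suc n) ^ p)"
          by (simp add: divide_right_mono)
        also have "\<dots> = real C * (1 / real (Suc n) ^ 2)"
          by (simp add: p_def power_add power2_eq_square del: of_nat_Suc)
        finally show "(\<Sum>h\<in>?B. l h) \<le> real C * (1 / real (Suc n) ^ 2)" .
      qed
      also have "\<dots> \<le> (\<Sum>n. real C * (1 / real (Suc n) ^ 2))"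
        using F by (intro sum_le_suminf summ) auto
      finally show ?thesis .
    qed
    then show "bdd_above (sum l ` {F. F \<subseteq> ?H \<and> finite F})" by (intro bdd_aboveI) auto
  qed
  then show ?thesis using l_pos near fin by blast
qed

end

section \<open>Diffeomorphisms between intervals\<close>

text \<open>The fundamental theorem of calculus tolerates finitely many exceptional points, so
  \<open>F\<close> is an integral of \<open>D\<close> up to a constant, and continuity of
  \<open>D\<close> yields the derivative at those points too.\<close>

lemma has_real_derivative_off_finite:
  fixes F D :: "real \<Rightarrow> real"
  assumes F: "continuous_on UNIV F" and D: "continuous_on UNIV D" and "finite S"
    and der: "\<And>x. x \<notin> S \<Longrightarrow> (F has_real_derivative D x) (at x)"
  shows "(F has_real_derivative D x) (at x)"
proof -
  let ?I = "{x - 1..x + 1}"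
  have eq: "integral {x - 1..y} D + F (x - 1) = F y" if "y \<in> ?I" for y
  proof -
    have "(D has_integral F y - F (x - 1)) {x - 1..y}"
      using that der
      by (intro fundamental_theorem_of_calculus_strong[OF \<open>finite S\<close>] continuous_on_subset[OF F])
        (auto simp: has_real_derivative_iff_has_vector_derivative)
    then show ?thesis by (simp add: integral_unique)
  qed
  have "((\<lambda>y. integral {x - 1..y} D) has_real_derivative D x) (at x within ?I)"
    by (rule integral_has_real_derivative) (auto intro: continuous_on_subset[OF D])
  then have "((\<lambda>y. integral {x - 1..y} D + F (x - 1)) has_real_derivative D x) (at x within ?I)"
    by (auto intro!: derivative_eq_intros)
  then have "(F has_real_derivative D x) (at x within ?I)"
    by (rule has_field_derivative_transform_within[of _ _ _ _ 1]) (use eq in auto)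
  moreover have "at x within ?I = at x" by (rule at_within_Icc_at) auto
  ultimately show ?thesis by simp
qed

text \<open>The flow of odd homeomorphisms of \<open>[-1, 1]\<close> that multiplies the coordinate \<open>v / (1 - \<bar>v\<bar>)\<close>
  by \<open>c\<close>. Its derivative is \<open>1 / c\<close> at both ends, so the map that it induces from an interval of
  length \<open>a\<close> to one of length \<open>c * a\<close> has derivative \<open>1\<close> there.\<close>

definition stretch :: "real \<Rightarrow> real \<Rightarrow> real" where
  "stretch c v = c * v / (1 + (c - 1) * \<bar>v\<bar>)"

lemma stretch_denom_pos: "0 < c \<Longrightarrow> \<bar>v\<bar> \<le> 1 \<Longrightarrow> 0 < 1 + (c - 1) * \<bar>v\<bar>" for c v :: real
proof -
  assume "0 < c" "\<bar>v\<bar> \<le> 1"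
  then have "0 < (1 - \<bar>v\<bar>) + c * \<bar>v\<bar>"
    by (cases "v = 0") (auto intro!: add_nonneg_pos)
  then show ?thesis by (simp add: algebra_simps)
qed

lemma abs_stretch: "0 < c \<Longrightarrow> \<bar>v\<bar> \<le> 1 \<Longrightarrow> \<bar>stretch c v\<bar> = c * \<bar>v\<bar> / (1 + (c - 1) * \<bar>v\<bar>)"
  using stretch_denom_pos[of c v] by (simp add: stretch_def abs_mult)

lemma abs_stretch_le: "0 < c \<Longrightarrow> \<bar>v\<bar> \<le> 1 \<Longrightarrow> \<bar>stretch c v\<bar> \<le> 1"
  using stretch_denom_pos[of c v] by (simp add: abs_stretch field_simps)

lemma stretch_ends: "0 < c \<Longrightarrow> stretch c 1 = 1" "0 < c \<Longrightarrow> stretch c (-1) = -1"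
  by (simp_all add: stretch_def)

lemma stretch_stretch:
  assumes "0 < c" "0 < d" "\<bar>v\<bar> \<le> 1"
  shows "stretch d (stretch c v) = stretch (d * c) v"
proof -
  define q where "q = 1 + (c - 1) * \<bar>v\<bar>"
  have q: "0 < q" using stretch_denom_pos assms by (simp add: q_def)
  have "1 + (d - 1) * \<bar>stretch c v\<bar> = (1 + (d * c - 1) * \<bar>v\<bar>) / q"
    using assms q by (simp add: abs_stretch q_def[symmetric] divide_simps) (simp add: q_def algebra_simps)
  moreover have "stretch c v = c * v / q" by (simp add: stretch_def q_def)
  ultimately show ?thesis using q unfolding stretch_def[of d] stretch_def[of "d * c"] by simp
qed

section \<open>The displacement of a stretched interval\<close>

definition clamp1 :: "real \<Rightarrow> real" where
  "clamp1 v = max (- 1) (min 1 v)"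

lemma abs_clamp1: "\<bar>clamp1 v\<bar> \<le> 1"
  by (auto simp: clamp1_def)

text \<open>In an interval of length \<open>a\<close> with coordinate \<open>v\<close>, the distance
  to the left end is \<open>a / 2 * (v + 1)\<close>; its image has distance
  \<open>c * a / 2 * (stretch c v + 1)\<close> in the target. This is their difference divided by
  \<open>a / 2\<close>, continued by constants outside.\<close>

definition bump :: "real \<Rightarrow> real \<Rightarrow> real" where
  "bump c v = c * (stretch c (clamp1 v) + 1) - (clamp1 v + 1)"

text \<open>At the clamped values \<open>1\<close> and \<open>-1\<close> the quotient is
  \<open>c / c\<close>, so the formula joins continuously with the derivative \<open>0\<close>
  outside.\<close>

definition bump_deriv :: "real \<Rightarrow> real \<Rightarrow> real" where
  "bump_deriv c v = (c / (1 + (c - 1) * \<bar>clamp1 v\<bar>)) ^ 2 - 1"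

lemma continuous_clamp1: "continuous_on S clamp1"
  unfolding clamp1_def by (intro continuous_intros)

lemma continuous_bump_deriv: "0 < c \<Longrightarrow> continuous_on S (bump_deriv c)"
  unfolding bump_deriv_def
  by (intro continuous_intros continuous_clamp1)
    (use stretch_denom_pos[OF _ abs_clamp1] in \<open>force simp: less_le\<close>)

text \<open>One computation for both halves of the interval: \<open>k = c - 1\<close> for positive
  and \<open>k = 1 - c\<close> for negative arguments.\<close>

lemma mobius_has_derivative:
  fixes c k x :: real
  assumes q: "1 + k * x \<noteq> 0"
  shows "((\<lambda>x. c * (c * x / (1 + k * x) + 1) - (x + 1)) has_real_derivative
    (c / (1 + k * x)) ^ 2 - 1) (at x)"
proof -
  have "((\<lambda>x. c * x / (1 + k * x)) has_real_derivative
      (c * (1 + k * x) - c * x * k) / ((1 + k * x) * (1 + k * x))) (at x)"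
    by (rule DERIV_divide) (use q in \<open>auto intro!: derivative_eq_intros\<close>)
  also have "c * (1 + k * x) - c * x * k = c" by (simp add: algebra_simps)
  finally have "((\<lambda>x. c * (c * x / (1 + k * x) + 1) - (x + 1)) has_real_derivative
      c * (c / ((1 + k * x) * (1 + k * x)) + 0) - (1 + 0)) (at x)"
    by (intro DERIV_diff DERIV_cmult DERIV_add DERIV_const DERIV_ident)
  then show ?thesis by (simp add: power2_eq_square)
qed

text \<open>Away from \<open>-1\<close>, \<open>0\<close> and \<open>1\<close>, where the clamp or
  the absolute value has a corner, the function is constant or rational. Continuity of the claimed
  derivative takes care of the corners.\<close>

lemma bump_has_derivative:
  assumes "0 < c"
  shows "(bump c has_real_derivative bump_deriv c v) (at v)"
proof (rule has_real_derivative_off_finite[of _ _ "{-1, 0, 1}"])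
  have nz: "1 + (c - 1) * \<bar>clamp1 x\<bar> \<noteq> 0" for x
    using stretch_denom_pos[OF assms abs_clamp1, of x] by simp
  show "continuous_on UNIV (bump c)"
    unfolding bump_def stretch_def
    by (intro continuous_intros continuous_clamp1) (use nz in auto)
  show "continuous_on UNIV (bump_deriv c)" using assms by (rule continuous_bump_deriv)
  fix x :: real assume x: "x \<notin> {-1, 0, 1}"
  then consider "x < -1" | "-1 < x" "x < 0" | "0 < x" "x < 1" | "1 < x" by fastforce
  then show "(bump c has_real_derivative bump_deriv c x) (at x)"
  proof cases
    case 1
    then have "bump_deriv c x = 0" using assms by (simp add: bump_deriv_def clamp1_def)
    moreover have "((\<lambda>x. bump c (-1)) has_real_derivative 0) (at x)" by simp
    then have "(bump c has_real_derivative 0) (at x)"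
      by (rule has_field_derivative_transform_within_open[of _ _ _ "{..<-1}"])
        (use 1 in \<open>auto simp: bump_def clamp1_def\<close>)
    ultimately show ?thesis by simp
  next
    case 2
    have q: "1 + (1 - c) * x \<noteq> 0"
      using stretch_denom_pos[OF assms, of x] 2 by (simp add: algebra_simps)
    have "(bump c has_real_derivative (c / (1 + (1 - c) * x)) ^ 2 - 1) (at x)"
      by (rule has_field_derivative_transform_within_open[OF mobius_has_derivative[OF q], of "{-1<..<0}"])
        (use 2 in \<open>auto simp: bump_def clamp1_def stretch_def algebra_simps\<close>)
    moreover have "1 + (1 - c) * x = 1 + (c - 1) * \<bar>clamp1 x\<bar>"
      using 2 by (simp add: clamp1_def algebra_simps)
    ultimately show ?thesis unfolding bump_deriv_def by simp
  next
    case 3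
    have q: "1 + (c - 1) * x \<noteq> 0" using stretch_denom_pos[OF assms, of x] 3 by simp
    have "(bump c has_real_derivative (c / (1 + (c - 1) * x)) ^ 2 - 1) (at x)"
      by (rule has_field_derivative_transform_within_open[OF mobius_has_derivative[OF q], of "{0<..<1}"])
        (use 3 in \<open>auto simp: bump_def clamp1_def stretch_def\<close>)
    then show ?thesis using 3 by (simp add: bump_deriv_def clamp1_def)
  next
    case 4
    then have "bump_deriv c x = 0" using assms by (simp add: bump_deriv_def clamp1_def)
    moreover have "((\<lambda>x. bump c 1) has_real_derivative 0) (at x)" by simp
    then have "(bump c has_real_derivative 0) (at x)"
      by (rule has_field_derivative_transform_within_open[of _ _ _ "{1<..}"])
        (use 4 in \<open>auto simp: bump_def clamp1_def\<close>)
    ultimately show ?thesis by simp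
  qed
qed simp

text \<open>The denominator lies between \<open>1\<close> and \<open>c\<close>, hence so does the
  quotient that is squared. The first bound drives uniform convergence, the second makes the
  realization strictly increasing.\<close>

lemma bump_deriv_bound:
  assumes "0 < c"
  shows "\<bar>bump_deriv c v\<bar> \<le> \<bar>c\<^sup>2 - 1\<bar>" "-1 < bump_deriv c v"
proof -
  define s where "s = \<bar>clamp1 v\<bar>"
  define q where "q = 1 + (c - 1) * s"
  have s: "0 \<le> s" "s \<le> 1" using abs_clamp1 by (auto simp: s_def)
  have q: "0 < q" using stretch_denom_pos[OF assms abs_clamp1] by (simp add: q_def s_def)
  have eq: "bump_deriv c v = (c / q) ^ 2 - 1" by (simp add: bump_deriv_def q_def s_def)
  show "-1 < bump_deriv c v" unfolding eq using assms q by simp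
  show "\<bar>bump_deriv c v\<bar> \<le> \<bar>c\<^sup>2 - 1\<bar>"
  proof (cases "1 \<le> c")
    case True
    have "(c - 1) * s \<le> c - 1" "0 \<le> (c - 1) * s"
      using True s by (auto intro: mult_left_le)
    then have 1: "1 \<le> q" "q \<le> c" unfolding q_def by linarith+
    then have "1 \<le> c / q" "c / q \<le> c" using q assms by (auto simp: field_simps)
    then have "1 \<le> (c / q)\<^sup>2" "(c / q)\<^sup>2 \<le> c\<^sup>2" by (auto intro: power_mono)
    then show ?thesis unfolding eq by linarith
  next
    case False
    have "(1 - c) * s \<le> 1 - c" "0 \<le> (1 - c) * s"
      using False s by (auto intro: mult_left_le)
    then have 1: "q \<le> 1" "c \<le> q" unfolding q_def by (simp_all add: algebra_simps)
    then have "c / q \<le> 1" "c \<le> c / q" using q assms by (auto simp: field_simps)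
    then have "(c / q)\<^sup>2 \<le> 1" "c\<^sup>2 \<le> (c / q)\<^sup>2"
      using q assms by (auto intro: power_mono simp: power_le_one)
    then show ?thesis unfolding eq by linarith
  qed
qed

lemma bump_deriv_outside: "0 < c \<Longrightarrow> v \<le> -1 \<or> 1 \<le> v \<Longrightarrow> bump_deriv c v = 0"
  by (auto simp: bump_deriv_def clamp1_def max_def min_def)

lemma bump_left: "0 < c \<Longrightarrow> v \<le> -1 \<Longrightarrow> bump c v = 0"
  by (simp add: bump_def clamp1_def stretch_ends)

lemma bump_right: "0 < c \<Longrightarrow> 1 \<le> v \<Longrightarrow> bump c v = 2 * (c - 1)"
  by (simp add: bump_def clamp1_def stretch_ends)

lemma bump_inside: "\<bar>v\<bar> \<le> 1 \<Longrightarrow> bump c v = c * (stretch c v + 1) - (v + 1)"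
  by (simp add: bump_def clamp1_def abs_le_iff)

lemma bump_one: "bump 1 v = 0"
  by (simp add: bump_def stretch_def)

section \<open>Realizing order automorphisms on the line\<close>

text \<open>The naturals serve only as labels of the intervals; \<open>prec\<close> is unrelated to
  their usual order.\<close>

locale weighted_order =
  fixes prec :: "nat \<Rightarrow> nat \<Rightarrow> bool" (infix "\<sqsubset>" 50) and l :: "nat \<Rightarrow> real"
  assumes prec_irrefl: "\<not> n \<sqsubset> n"
    and prec_trans: "k \<sqsubset> m \<Longrightarrow> m \<sqsubset> n \<Longrightarrow> k \<sqsubset> n"
    and prec_total: "m \<noteq> n \<Longrightarrow> m \<sqsubset> n \<or> n \<sqsubset> m"
    and l_pos: "0 < l n"
    and l_sums: "l sums 1"
begin

section \<open>Layout of the intervals\<close>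

definition left :: "nat \<Rightarrow> real" where
  "left n = infsum l {m. m \<sqsubset> n}"

lemma l_has_sum: "(l has_sum 1) UNIV"
  using l_sums by (rule sums_nonneg_imp_has_sum) (use l_pos in \<open>simp add: less_imp_le\<close>)

lemma l_summable_on: "l summable_on A"
  using summable_on_subset_banach[of l UNIV A] l_has_sum by (auto simp: summable_on_def)

lemma infsum_l_UNIV: "infsum l UNIV = 1"
  using l_has_sum by (rule infsumI)

lemma infsum_l_mono: "A \<subseteq> B \<Longrightarrow> infsum l A \<le> infsum l B"
  by (rule infsum_mono_neutral) (use l_pos l_summable_on in \<open>auto simp: less_imp_le\<close>)

lemma infsum_l_finite_le: "finite F \<Longrightarrow> F \<subseteq> A \<Longrightarrow> sum l F \<le> infsum l A"
  using infsum_l_mono[of F A] by simp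

lemma left_nonneg: "0 \<le> left n"
  unfolding left_def by (rule infsum_nonneg) (use l_pos in \<open>simp add: less_imp_le\<close>)

lemma infsum_insert_left: "infsum l (insert n {m. m \<sqsubset> n}) = left n + l n"
  unfolding left_def using l_summable_on prec_irrefl by (subst infsum_insert) (auto simp: add.commute)

lemma left_le:
  assumes "m \<sqsubset> n"
  shows "left m + l m \<le> left n"
proof -
  have "insert m {k. k \<sqsubset> m} \<subseteq> {k. k \<sqsubset> n}" using assms prec_trans by blast
  from infsum_l_mono[OF this] show ?thesis by (simp add: infsum_insert_left left_def[of n])
qed

lemma right_le_one: "left n + l n \<le> 1"
  unfolding infsum_insert_left[symmetric] infsum_l_UNIV[symmetric]
  by (rule infsum_l_mono) auto

lemma left_inj: "m \<noteq> n \<Longrightarrow> left m \<noteq> left n"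
  using prec_total[of m n] left_le l_pos by (smt (verit))

text \<open>The affine chart from the interval of \<open>n\<close> to \<open>[-1, 1]\<close>, where
  \<open>stretch\<close> acts.\<close>

definition coord :: "nat \<Rightarrow> real \<Rightarrow> real" where
  "coord n x = 2 * (x - left n) / l n - 1"

lemma coord_le: "coord n x \<le> -1 \<longleftrightarrow> x \<le> left n"
  using l_pos[of n] by (simp add: coord_def field_simps)

lemma coord_ge: "1 \<le> coord n x \<longleftrightarrow> left n + l n \<le> x"
  using l_pos[of n] by (auto simp: coord_def field_simps)

lemma coord_abs: "\<bar>coord n x\<bar> \<le> 1 \<longleftrightarrow> left n \<le> x \<and> x \<le> left n + l n"
  using l_pos[of n] by (auto simp: coord_def field_simps abs_le_iff)

lemma coord_inverse: "x = left n + l n / 2 * (coord n x + 1)"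
  using l_pos[of n] by (simp add: coord_def field_simps)

lemma finite_prec_bounds:
  assumes "finite F" "F \<noteq> {}"
  shows "\<exists>n\<in>F. \<forall>m\<in>F. m = n \<or> m \<sqsubset> n" "\<exists>n\<in>F. \<forall>m\<in>F. m = n \<or> n \<sqsubset> m"
  using assms
proof (induction F rule: finite_ne_induct)
  case (insert x F)
  {
    case 1
    then show ?case using insert(4) prec_total prec_trans by (metis insert_iff)
  next
    case 2
    then show ?case using insert(5) prec_total prec_trans by (metis insert_iff)
  }
qed auto

text \<open>The intervals have total length \<open>1\<close>, so the Cantor set left over by their interiors has
  empty interior.\<close>

lemma intervals_dense:
  assumes "0 \<le> a" "a < b" "b \<le> 1"
  shows "\<exists>n x. a < x \<and> x < b \<and> left n \<le> x \<and> x \<le> left n + l n"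
proof (rule ccontr)
  assume none: "\<not> ?thesis"
  have dich: "left n + l n \<le> a \<or> b \<le> left n" for n
  proof (rule ccontr)
    assume "\<not> ?thesis"
    then obtain x where "max a (left n) < x" "x < min b (left n + l n)"
      using assms l_pos[of n] dense[of "max a (left n)" "min b (left n + l n)"] by auto
    then have "a < x \<and> x < b \<and> left n \<le> x \<and> x \<le> left n + l n" by simp
    then show False using none by blast
  qed
  \<comment> \<open>The intervals on either side of the gap are too short: among finitely many
    intervals left of \<open>a\<close> the \<open>prec\<close>-last one bounds their total by
    \<open>a\<close>, and symmetrically the rest have total at most \<open>1 - b\<close>. Together
    they should have total \<open>1\<close>.\<close>
  let ?A = "{n. left n + l n \<le> a}"
  have A: "infsum l ?A \<le> a"
  proof (rule infsum_le_finite_sums[OF l_summable_on])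
    fix F assume F: "finite F" "F \<subseteq> ?A"
    show "sum l F \<le> a"
    proof (cases "F = {}")
      case False
      then obtain n where n: "n \<in> F" "\<forall>m\<in>F. m = n \<or> m \<sqsubset> n" using finite_prec_bounds(1)[OF F(1)] by blast
      then have "sum l F \<le> infsum l (insert n {m. m \<sqsubset> n})" by (intro infsum_l_finite_le F) auto
      then show ?thesis using infsum_insert_left[of n] n F by auto
    qed (use assms in simp)
  qed
  have B: "infsum l (- ?A) \<le> 1 - b"
  proof (rule infsum_le_finite_sums[OF l_summable_on])
    fix F assume F: "finite F" "F \<subseteq> - ?A"
    show "sum l F \<le> 1 - b"
    proof (cases "F = {}")
      case False
      then obtain n where n: "n \<in> F" "\<forall>m\<in>F. m = n \<or> n \<sqsubset> m" using finite_prec_bounds(2)[OF F(1)] by blast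
      have "\<not> m \<sqsubset> n" if "m \<in> F" for m using n(2) that prec_irrefl prec_trans by metis
      then have "F \<subseteq> - {m. m \<sqsubset> n}" by blast
      then have "sum l F \<le> infsum l (- {m. m \<sqsubset> n})" using F by (intro infsum_l_finite_le)
      moreover have "infsum l (- {m. m \<sqsubset> n}) + left n = 1"
        unfolding left_def infsum_l_UNIV[symmetric]
        using infsum_Un_disjoint[OF l_summable_on l_summable_on, of "- {m. m \<sqsubset> n}" "{m. m \<sqsubset> n}"]
        by (simp add: Un_commute Compl_partition)
      moreover have "b \<le> left n" using dich n F by blast
      ultimately show ?thesis by linarith
    qed (use assms in simp)
  qed
  have "infsum l ?A + infsum l (- ?A) = 1"
    using infsum_Un_disjoint[OF l_summable_on l_summable_on, of ?A "- ?A"]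
    by (simp add: Compl_partition infsum_l_UNIV)
  then show False using A B assms by linarith
qed

section \<open>The displacement series and its derivative\<close>

text \<open>Beyond the interval of \<open>n\<close> this term is the constant
  \<open>l (\<sigma> n) - l n\<close>, so the intervals preceding a point push it from its old
  offset to the new one.\<close>

definition shift_term :: "(nat \<Rightarrow> nat) \<Rightarrow> nat \<Rightarrow> real \<Rightarrow> real" where
  "shift_term \<sigma> n x = l n / 2 * bump (l (\<sigma> n) / l n) (coord n x)"

definition shift_term_deriv :: "(nat \<Rightarrow> nat) \<Rightarrow> nat \<Rightarrow> real \<Rightarrow> real" where
  "shift_term_deriv \<sigma> n x = bump_deriv (l (\<sigma> n) / l n) (coord n x)"

text \<open>The map that sends the interval of \<open>n\<close> to that of \<open>\<sigma> n\<close>, written as a perturbation of the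
  identity so that it is given by one series on the whole line.\<close>

definition realization :: "(nat \<Rightarrow> nat) \<Rightarrow> real \<Rightarrow> real" where
  "realization \<sigma> x = x + (\<Sum>n. shift_term \<sigma> n x)"

text \<open>The limit along the labels means that only finitely many ratios are far from
  \<open>1\<close>; it is the source of the continuity of the derivative.\<close>

definition admissible :: "(nat \<Rightarrow> nat) \<Rightarrow> bool" where
  "admissible \<sigma> \<longleftrightarrow> bij \<sigma> \<and> (\<forall>m n. m \<sqsubset> n \<longrightarrow> \<sigma> m \<sqsubset> \<sigma> n) \<and> (\<lambda>n. l (\<sigma> n) / l n) \<longlonglongrightarrow> 1"

lemma ratio_pos: "0 < l m / l n"
  using l_pos by simp

lemma shift_term_has_derivative:
  "(shift_term \<sigma> n has_real_derivative shift_term_deriv \<sigma> n x) (at x)"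
proof -
  have "(coord n has_real_derivative 2 / l n) (at x)"
    unfolding coord_def using l_pos[of n] by (auto intro!: derivative_eq_intros)
  then have "((\<lambda>x. bump (l (\<sigma> n) / l n) (coord n x)) has_real_derivative
      bump_deriv (l (\<sigma> n) / l n) (coord n x) * (2 / l n)) (at x)"
    by (rule DERIV_chain2[OF bump_has_derivative[OF ratio_pos]])
  then have "((\<lambda>x. l n / 2 * bump (l (\<sigma> n) / l n) (coord n x)) has_real_derivative
      l n / 2 * (bump_deriv (l (\<sigma> n) / l n) (coord n x) * (2 / l n))) (at x)"
    by (rule DERIV_cmult)
  then show ?thesis
    using l_pos[of n] unfolding shift_term_deriv_def shift_term_def[abs_def] by simp
qed

lemma shift_term_left: "x \<le> left n \<Longrightarrow> shift_term \<sigma> n x = 0"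
  using coord_le[of n x] by (simp add: shift_term_def bump_left[OF ratio_pos])

lemma shift_term_right: "left n + l n \<le> x \<Longrightarrow> shift_term \<sigma> n x = l (\<sigma> n) - l n"
  using coord_ge[of n x] l_pos[of n]
  by (simp add: shift_term_def bump_right[OF ratio_pos] field_simps)

lemma shift_term_deriv_outside:
  "\<not> (left n < x \<and> x < left n + l n) \<Longrightarrow> shift_term_deriv \<sigma> n x = 0"
  unfolding shift_term_deriv_def using coord_le[of n x] coord_ge[of n x]
  by (intro bump_deriv_outside[OF ratio_pos]) auto

text \<open>Distinct intervals have disjoint interiors, so at most one term of the series of
  derivatives is nonzero at a given point.\<close>

lemma shift_term_deriv_unique:
  assumes "left n < x" "x < left n + l n"
  shows "shift_term_deriv \<sigma> m x = (if m = n then shift_term_deriv \<sigma> n x else 0)"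
proof (cases "m = n")
  case False
  then have "\<not> (left m < x \<and> x < left m + l m)"
    using assms prec_total[OF False] left_le[of m n] left_le[of n m] by auto
  then show ?thesis using False shift_term_deriv_outside by simp
qed simp

lemma shift_term_deriv_sums:
  "(\<lambda>n. shift_term_deriv \<sigma> n x) sums (\<Sum>n. shift_term_deriv \<sigma> n x)" (is ?sums)
  "-1 < (\<Sum>n. shift_term_deriv \<sigma> n x)" (is ?pos)
proof -
  have "?sums \<and> ?pos"
  proof (cases "\<exists>n. left n < x \<and> x < left n + l n")
    case True
    then obtain n where n: "left n < x" "x < left n + l n" by blast
    have "(\<lambda>m. shift_term_deriv \<sigma> m x) sums shift_term_deriv \<sigma> n x"
      by (subst shift_term_deriv_unique[OF n], rule sums_single[of n "\<lambda>_. shift_term_deriv \<sigma> n x"])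
    moreover have "-1 < shift_term_deriv \<sigma> n x"
      unfolding shift_term_deriv_def by (rule bump_deriv_bound[OF ratio_pos])
    ultimately show ?thesis by (simp add: sums_iff)
  next
    case False
    then have "shift_term_deriv \<sigma> n x = 0" for n using shift_term_deriv_outside by blast
    then show ?thesis by simp
  qed
  then show ?sums ?pos by blast+
qed

text \<open>At each point a tail of the series is at most a single term, so it suffices that the sup
  bounds of the terms tend to \<open>0\<close>. They need not be summable, which rules out the
  Weierstrass test.\<close>

lemma shift_term_deriv_uniform_limit:
  assumes "admissible \<sigma>"
  shows "uniform_limit UNIV (\<lambda>N x. \<Sum>n<N. shift_term_deriv \<sigma> n x)
    (\<lambda>x. \<Sum>n. shift_term_deriv \<sigma> n x) sequentially"
proof (rule uniform_limitI)
  fix e :: real assume "0 < e"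
  have "(\<lambda>n. (l (\<sigma> n) / l n)\<^sup>2 - 1) \<longlonglongrightarrow> 1\<^sup>2 - 1"
    using assms unfolding admissible_def by (intro tendsto_intros) auto
  then have "\<forall>\<^sub>F n in sequentially. \<bar>(l (\<sigma> n) / l n)\<^sup>2 - 1\<bar> < e"
    using \<open>0 < e\<close> by (auto dest: tendstoD simp: dist_real_def)
  then obtain M where M: "\<And>n. n \<ge> M \<Longrightarrow> \<bar>(l (\<sigma> n) / l n)\<^sup>2 - 1\<bar> < e"
    by (auto simp: eventually_sequentially)
  have "dist (\<Sum>n<N. shift_term_deriv \<sigma> n x) (\<Sum>n. shift_term_deriv \<sigma> n x) < e" if "N \<ge> M" for N x
  proof (cases "\<exists>n. left n < x \<and> x < left n + l n")
    case True
    then obtain n where n: "left n < x" "x < left n + l n" by blast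
    have fin: "(\<Sum>m<N. shift_term_deriv \<sigma> m x) = (if n < N then shift_term_deriv \<sigma> n x else 0)"
      by (subst shift_term_deriv_unique[OF n]) (simp add: sum.delta)
    have inf: "(\<Sum>m. shift_term_deriv \<sigma> m x) = shift_term_deriv \<sigma> n x"
      by (subst shift_term_deriv_unique[OF n],
          rule sums_unique[symmetric], rule sums_single[of n "\<lambda>_. shift_term_deriv \<sigma> n x"])
    show ?thesis
    proof (cases "n < N")
      case False
      then have "\<bar>shift_term_deriv \<sigma> n x\<bar> < e"
        unfolding shift_term_deriv_def
        using bump_deriv_bound(1)[OF ratio_pos] M[of n] that by (meson le_less_trans linorder_not_less order_trans)
      then show ?thesis unfolding fin inf using False by (simp add: dist_real_def)
    qed (use fin inf \<open>0 < e\<close> in simp)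
  next
    case False
    then have "shift_term_deriv \<sigma> n x = 0" for n using shift_term_deriv_outside by blast
    then show ?thesis using \<open>0 < e\<close> by simp
  qed
  then show "\<forall>\<^sub>F N in sequentially. \<forall>x\<in>UNIV.
      dist (\<Sum>n<N. shift_term_deriv \<sigma> n x) (\<Sum>n. shift_term_deriv \<sigma> n x) < e"
    by (auto simp: eventually_sequentially)
qed

text \<open>Termwise differentiation needs uniform convergence of the derivatives and convergence at
  one point; at \<open>0\<close> all terms vanish. Positivity holds because the sum of the
  derivatives exceeds \<open>-1\<close>.\<close>

lemma realization_C1:
  assumes "admissible \<sigma>"
  shows "\<exists>D. continuous_on UNIV D \<and> (\<forall>x. 0 < D x \<and> (realization \<sigma> has_real_derivative D x) (at x))"
proof (intro exI conjI allI)
  let ?D = "\<lambda>x. 1 + (\<Sum>n. shift_term_deriv \<sigma> n x)"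
  have "continuous_on UNIV (shift_term_deriv \<sigma> n)" for n
  proof -
    have "continuous_on UNIV (\<lambda>x. bump_deriv (l (\<sigma> n) / l n) (coord n x))"
      by (rule continuous_on_compose2[OF continuous_bump_deriv[OF ratio_pos, of UNIV]])
        (use l_pos[of n] in \<open>auto simp: coord_def intro!: continuous_intros\<close>)
    then show ?thesis by (simp add: shift_term_deriv_def[abs_def])
  qed
  then have "continuous_on UNIV (\<lambda>x. \<Sum>n. shift_term_deriv \<sigma> n x)"
    by (intro uniform_limit_theorem[OF _ shift_term_deriv_uniform_limit[OF assms]])
      (auto intro!: always_eventually continuous_on_sum)
  then show "continuous_on UNIV ?D" by (intro continuous_intros)
  fix x
  show "0 < ?D x" using shift_term_deriv_sums(2)[of \<sigma> x] by simp
  have "((\<lambda>x. \<Sum>n. shift_term \<sigma> n x) has_field_derivative (\<Sum>n. shift_term_deriv \<sigma> n x)) (at x)"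
  proof (rule has_field_derivative_series'(2)[of UNIV _ _ 0])
    show "uniformly_convergent_on UNIV (\<lambda>N x. \<Sum>n<N. shift_term_deriv \<sigma> n x)"
      using shift_term_deriv_uniform_limit[OF assms] unfolding uniformly_convergent_on_def by blast
    show "summable (\<lambda>n. shift_term \<sigma> n 0)"
      using shift_term_left[OF left_nonneg] by simp
  qed (auto simp: shift_term_has_derivative)
  then show "(realization \<sigma> has_real_derivative ?D x) (at x)"
    unfolding realization_def[abs_def] by (intro DERIV_add DERIV_ident)
qed

section \<open>Values on the intervals and the composition law\<close>

lemma admissible_prec_iff: "admissible \<sigma> \<Longrightarrow> \<sigma> m \<sqsubset> \<sigma> n \<longleftrightarrow> m \<sqsubset> n"
  using prec_total prec_irrefl prec_trans unfolding admissible_def by metis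

lemma left_admissible_has_sum:
  assumes "admissible \<sigma>"
  shows "((\<lambda>m. l (\<sigma> m)) has_sum left (\<sigma> n)) {m. m \<sqsubset> n}"
proof -
  have "bij_betw \<sigma> {m. m \<sqsubset> n} {m. m \<sqsubset> \<sigma> n}"
  proof (rule bij_betw_imageI)
    show "inj_on \<sigma> {m. m \<sqsubset> n}" using assms unfolding admissible_def bij_def by (auto intro: inj_on_subset)
    show "\<sigma> ` {m. m \<sqsubset> n} = {m. m \<sqsubset> \<sigma> n}"
    proof (intro subset_antisym subsetI)
      fix k assume k: "k \<in> {m. m \<sqsubset> \<sigma> n}"
      obtain m where "k = \<sigma> m" using assms unfolding admissible_def by (metis bij_pointE)
      then show "k \<in> \<sigma> ` {m. m \<sqsubset> n}" using k admissible_prec_iff[OF assms] by auto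
    qed (use admissible_prec_iff[OF assms] in auto)
  qed
  then show ?thesis unfolding left_def
    by (subst has_sum_reindex_bij_betw) (auto intro: has_sum_infsum l_summable_on)
qed

text \<open>Intervals before that of \<open>n\<close> contribute their full change of length, with
  total \<open>left (\<sigma> n) - left n\<close>; later intervals contribute nothing.\<close>

lemma realization_interval:
  assumes "admissible \<sigma>" and x: "left n \<le> x" "x \<le> left n + l n"
  shows "realization \<sigma> x = left (\<sigma> n) + l (\<sigma> n) / 2 * (stretch (l (\<sigma> n) / l n) (coord n x) + 1)"
proof -
  have term_eq: "shift_term \<sigma> m x =
      (if m \<sqsubset> n then l (\<sigma> m) - l m else 0) + (if m = n then shift_term \<sigma> n x else 0)" for m
  proof -
    consider "m = n" | "m \<sqsubset> n" "m \<noteq> n" | "n \<sqsubset> m" "\<not> m \<sqsubset> n" "m \<noteq> n"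
      using prec_total prec_irrefl prec_trans by metis
    then show ?thesis
    proof cases
      case 1
      then show ?thesis using prec_irrefl by simp
    next
      case 2
      then show ?thesis using shift_term_right[of m x \<sigma>] left_le[of m n] x by simp
    next
      case 3
      then show ?thesis using shift_term_left[of x m \<sigma>] left_le[of n m] x by simp
    qed
  qed
  have "((\<lambda>m. l (\<sigma> m) - l m) has_sum (left (\<sigma> n) - left n)) {m. m \<sqsubset> n}"
    using has_sum_add[OF left_admissible_has_sum[OF assms(1), of n], of "\<lambda>m. - l m" "- left n"]
      l_summable_on
    by (simp add: has_sum_uminus left_def)
  then have "((\<lambda>m. if m \<sqsubset> n then l (\<sigma> m) - l m else 0) has_sum (left (\<sigma> n) - left n)) UNIV"
    by (subst has_sum_cong_neutral[where T = "{m. m \<sqsubset> n}" and g = "\<lambda>m. l (\<sigma> m) - l m"]) auto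
  then have "(\<lambda>m. shift_term \<sigma> m x) sums ((left (\<sigma> n) - left n) + shift_term \<sigma> n x)"
    by (subst term_eq) (intro sums_add has_sum_imp_sums sums_single[of n "\<lambda>_. shift_term \<sigma> n x"])
  then have "realization \<sigma> x = x + (left (\<sigma> n) - left n) + shift_term \<sigma> n x"
    by (simp add: realization_def sums_iff)
  also have "shift_term \<sigma> n x =
      l (\<sigma> n) / 2 * (stretch (l (\<sigma> n) / l n) (coord n x) + 1) - l n / 2 * (coord n x + 1)"
    using x l_pos[of n] by (simp add: shift_term_def bump_inside coord_abs right_diff_distrib)
  finally show ?thesis using coord_inverse[of x n] by linarith
qed

lemma realization_outside:
  assumes "admissible \<sigma>" "x \<le> 0 \<or> 1 \<le> x"
  shows "realization \<sigma> x = x"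
  using assms(2)
proof
  assume "x \<le> 0"
  then have "shift_term \<sigma> n x = 0" for n using left_nonneg[of n] by (intro shift_term_left) simp
  then show ?thesis by (simp add: realization_def)
next
  assume "1 \<le> x"
  then have term_eq: "shift_term \<sigma> n x = l (\<sigma> n) - l n" for n
    using right_le_one[of n] by (intro shift_term_right) simp
  have "((\<lambda>n. l (\<sigma> n)) has_sum 1) UNIV"
    using assms(1) l_has_sum unfolding admissible_def by (subst has_sum_reindex_bij_betw) auto
  then have "(\<lambda>n. l (\<sigma> n) - l n) sums (1 - 1)"
    by (intro sums_diff has_sum_imp_sums l_has_sum)
  then show ?thesis by (simp add: realization_def term_eq sums_iff)
qed

lemma realization_coord:
  assumes "admissible \<sigma>" and x: "left n \<le> x" "x \<le> left n + l n"
  shows "coord (\<sigma> n) (realization \<sigma> x) = stretch (l (\<sigma> n) / l n) (coord n x)"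
  unfolding realization_interval[OF assms] coord_def[of "\<sigma> n"] using l_pos[of "\<sigma> n"] by simp

text \<open>Both sides are continuous. They agree outside the unit interval, and on each interval by
  \<open>stretch_stretch\<close>, since the length ratios multiply; the intervals meet every open
  subinterval of \<open>[0, 1]\<close>.\<close>

lemma realization_compose:
  assumes \<sigma>: "admissible \<sigma>" and \<tau>: "admissible \<tau>" and \<tau>\<sigma>: "admissible (\<tau> \<circ> \<sigma>)"
  shows "realization \<tau> (realization \<sigma> x) = realization (\<tau> \<circ> \<sigma>) x"
proof -
  have cont: "continuous_on UNIV (realization \<rho>)" if "admissible \<rho>" for \<rho>
    using realization_C1[OF that] by (meson DERIV_isCont continuous_at_imp_continuous_on)
  let ?E = "{x. realization \<tau> (realization \<sigma> x) = realization (\<tau> \<circ> \<sigma>) x}"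
  have "closed ?E"
    by (intro closed_Collect_eq continuous_on_compose2[OF cont[OF \<tau>] cont[OF \<sigma>]] cont[OF \<tau>\<sigma>]) auto
  have out: "x \<in> ?E" if "x \<le> 0 \<or> 1 \<le> x" for x
    using that by (simp add: realization_outside[OF \<sigma>] realization_outside[OF \<tau>] realization_outside[OF \<tau>\<sigma>])
  have inside: "x \<in> ?E" if x: "left n \<le> x" "x \<le> left n + l n" for n x
  proof -
    let ?y = "realization \<sigma> x"
    have "\<bar>coord (\<sigma> n) ?y\<bar> \<le> 1"
      unfolding realization_coord[OF \<sigma> x]
      by (rule abs_stretch_le[OF ratio_pos]) (use x in \<open>simp add: coord_abs\<close>)
    then have y: "left (\<sigma> n) \<le> ?y" "?y \<le> left (\<sigma> n) + l (\<sigma> n)" by (auto simp: coord_abs)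
    have "stretch (l (\<tau> (\<sigma> n)) / l (\<sigma> n)) (coord (\<sigma> n) ?y) = stretch (l (\<tau> (\<sigma> n)) / l n) (coord n x)"
      unfolding realization_coord[OF \<sigma> x]
      using x l_pos[of "\<sigma> n"] by (subst stretch_stretch[OF ratio_pos ratio_pos]) (auto simp: coord_abs)
    then show ?thesis
      using realization_interval[OF \<tau> y] realization_interval[OF \<tau>\<sigma> x] by simp
  qed
  have "x \<in> closure ?E"
  proof (rule ccontr)
    assume "x \<notin> closure ?E"
    then obtain d where d: "0 < d" "\<And>y. \<bar>y - x\<bar> < d \<Longrightarrow> y \<notin> ?E"
      unfolding closure_approachable dist_real_def by blast
    then have "x \<notin> ?E" by (metis abs_zero diff_self)
    then have x01: "0 < x" "x < 1" using out[of x] by (auto simp: not_le[symmetric])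
    define b where "b = min 1 (x + d)"
    have "x < b" "b \<le> 1" "b \<le> x + d" using d x01 by (auto simp: b_def)
    then obtain n y where "x < y" "y < b" "left n \<le> y" "y \<le> left n + l n"
      using intervals_dense[of x b] x01 by auto
    then show False using inside[of n y] d(2)[of y] \<open>b \<le> x + d\<close> by auto
  qed
  then show ?thesis using \<open>closed ?E\<close> by (simp add: closure_closed)
qed

lemma realization_id: "realization id x = x"
  using l_pos by (simp add: realization_def shift_term_def bump_one less_imp_neq[symmetric])

text \<open>Left ends go to left ends, and distinct labels have distinct left ends.\<close>

lemma realization_nontrivial:
  assumes "admissible \<sigma>" "\<sigma> n \<noteq> n"
  shows "realization \<sigma> (left n) \<noteq> left n"
proof -
  have "coord n (left n) = -1" by (simp add: coord_def)
  then have "realization \<sigma> (left n) = left (\<sigma> n)"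
    using realization_interval[OF assms(1), of n "left n"] l_pos[of n]
    by (simp add: stretch_ends[OF ratio_pos] less_imp_le)
  then show ?thesis using left_inj[OF assms(2)] by simp
qed

end

section \<open>Actions on the interval, the line and the circle\<close>

text \<open>Bijectivity and the form of the inverse follow from the action laws and are handed to
  the membership condition for \<open>D\<close>, so that only regularity remains to be checked for a
  concrete \<open>D\<close>.\<close>

lemma (in group) faithful_action_isomorphic_to_subgroup:
  assumes ext: "\<And>a. a \<in> carrier G \<Longrightarrow> \<Psi> a \<in> extensional S"
    and maps: "\<And>a x. a \<in> carrier G \<Longrightarrow> x \<in> S \<Longrightarrow> \<Psi> a x \<in> S"
    and mult: "\<And>a b x. a \<in> carrier G \<Longrightarrow> b \<in> carrier G \<Longrightarrow> x \<in> S \<Longrightarrow> \<Psi> (a \<otimes> b) x = \<Psi> a (\<Psi> b x)"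
    and one: "\<And>x. x \<in> S \<Longrightarrow> \<Psi> \<one> x = x"
    and faithful: "\<And>a. a \<in> carrier G \<Longrightarrow> a \<noteq> \<one> \<Longrightarrow> \<exists>x\<in>S. \<Psi> a x \<noteq> x"
    and D: "\<And>a. a \<in> carrier G \<Longrightarrow> \<Psi> a \<in> Bij S \<Longrightarrow>
      (\<And>x. x \<in> S \<Longrightarrow> inv_into S (\<Psi> a) x = \<Psi> (inv a) x) \<Longrightarrow> \<Psi> a \<in> D"
    and DB: "D \<subseteq> Bij S"
  shows "isomorphic_to_subgroup G (BijGroup S\<lparr>carrier := D\<rparr>)"
proof -
  have inv_left: "\<Psi> (inv a) (\<Psi> a x) = x" and inv_right: "\<Psi> a (\<Psi> (inv a) x) = x"
    if "a \<in> carrier G" "x \<in> S" for a x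
    using mult[of "inv a" a x] mult[of a "inv a" x] one that by auto
  have bij: "\<Psi> a \<in> Bij S" if a: "a \<in> carrier G" for a
  proof -
    have "bij_betw (\<Psi> a) S S"
      by (rule bij_betw_byWitness[of _ "\<Psi> (inv a)"]) (use a inv_left inv_right maps in auto)
    then show ?thesis using ext[OF a] by (simp add: Bij_def)
  qed
  have inv: "inv_into S (\<Psi> a) x = \<Psi> (inv a) x" if a: "a \<in> carrier G" and x: "x \<in> S" for a x
    by (rule inv_into_f_eq) (use bij[OF a] a x maps inv_right in \<open>auto simp: Bij_def bij_betw_def\<close>)
  have \<Psi>D: "\<Psi> a \<in> D" if "a \<in> carrier G" for a
    using D bij inv that by blast
  interpret B: group "BijGroup S" by (rule group_BijGroup)
  have comp: "\<Psi> (a \<otimes> b) = compose S (\<Psi> a) (\<Psi> b)" if "a \<in> carrier G" "b \<in> carrier G" for a b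
    using that ext[of "a \<otimes> b"] mult
    by (intro extensionalityI[of _ S]) (auto simp: compose_def)
  have hom: "\<Psi> \<in> hom G (BijGroup S)"
    by (rule homI) (auto simp: BijGroup_def bij comp)
  have inj: "inj_on \<Psi> (carrier G)"
  proof (rule inj_onI)
    fix a b assume ab: "a \<in> carrier G" "b \<in> carrier G" "\<Psi> a = \<Psi> b"
    have "\<Psi> (inv b \<otimes> a) x = x" if "x \<in> S" for x
      using mult[of "inv b" a x] inv_left[of b x] ab that by simp
    then have "inv b \<otimes> a = \<one>" using faithful[of "inv b \<otimes> a"] ab by blast
    then show "a = b" using ab by (metis inv_equality inv_inv inv_closed)
  qed
  let ?H = "\<Psi> ` carrier G"
  interpret hom: group_hom G "BijGroup S" \<Psi>
    using hom by unfold_locales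
  have H: "subgroup ?H (BijGroup S)" by (rule hom.img_is_subgroup)
  have "subgroup ?H (BijGroup S\<lparr>carrier := D\<rparr>)"
  proof
    show "?H \<subseteq> carrier (BijGroup S\<lparr>carrier := D\<rparr>)" using \<Psi>D by auto
    show "\<one>\<^bsub>BijGroup S\<lparr>carrier := D\<rparr>\<^esub> \<in> ?H" using subgroup.one_closed[OF H] by simp
    show "x \<otimes>\<^bsub>BijGroup S\<lparr>carrier := D\<rparr>\<^esub> y \<in> ?H" if "x \<in> ?H" "y \<in> ?H" for x y
      using subgroup.m_closed[OF H that] by simp
    show "inv\<^bsub>BijGroup S\<lparr>carrier := D\<rparr>\<^esub> x \<in> ?H" if x: "x \<in> ?H" for x
    proof -
      have ix: "inv\<^bsub>BijGroup S\<^esub> x \<in> ?H" using subgroup.m_inv_closed[OF H x] .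
      have c: "x \<in> carrier (BijGroup S)" using x subgroup.mem_carrier[OF H] by blast
      \<comment> \<open>\<open>D\<close> is not known to be a group, so its inverse operation is
        unfolded as a definite description and uniqueness is imported from
        \<open>BijGroup S\<close>.\<close>
      have DB': "D \<subseteq> carrier (BijGroup S)" using DB by (simp add: BijGroup_def)
      have "inv\<^bsub>BijGroup S\<lparr>carrier := D\<rparr>\<^esub> x = inv\<^bsub>BijGroup S\<^esub> x"
        unfolding m_inv_def[of "BijGroup S\<lparr>carrier := D\<rparr>"]
      proof (rule the_equality)
        show "inv\<^bsub>BijGroup S\<^esub> x \<in> carrier (BijGroup S\<lparr>carrier := D\<rparr>) \<and>
            x \<otimes>\<^bsub>BijGroup S\<lparr>carrier := D\<rparr>\<^esub> inv\<^bsub>BijGroup S\<^esub> x = \<one>\<^bsub>BijGroup S\<lparr>carrier := D\<rparr>\<^esub> \<and>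
            inv\<^bsub>BijGroup S\<^esub> x \<otimes>\<^bsub>BijGroup S\<lparr>carrier := D\<rparr>\<^esub> x = \<one>\<^bsub>BijGroup S\<lparr>carrier := D\<rparr>\<^esub>"
          using ix \<Psi>D c by auto
      next
        fix y assume "y \<in> carrier (BijGroup S\<lparr>carrier := D\<rparr>) \<and>
            x \<otimes>\<^bsub>BijGroup S\<lparr>carrier := D\<rparr>\<^esub> y = \<one>\<^bsub>BijGroup S\<lparr>carrier := D\<rparr>\<^esub> \<and>
            y \<otimes>\<^bsub>BijGroup S\<lparr>carrier := D\<rparr>\<^esub> x = \<one>\<^bsub>BijGroup S\<lparr>carrier := D\<rparr>\<^esub>"
        then show "y = inv\<^bsub>BijGroup S\<^esub> x"
          using DB' c by (auto intro!: B.inv_equality[symmetric])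
      qed
      then show ?thesis using ix by simp
    qed
  qed
  moreover have "\<Psi> \<in> iso G (BijGroup S\<lparr>carrier := ?H\<rparr>)"
    using hom inj by (auto simp: iso_def hom_def bij_betw_def)
  then have "G \<cong> BijGroup S\<lparr>carrier := ?H\<rparr>" by (auto simp: is_iso_def)
  ultimately show ?thesis unfolding isomorphic_to_subgroup_def by (intro exI[of _ ?H]) simp
qed

section \<open>Angles on the circle\<close>

lemma Arg2pi_cis: "0 \<le> t \<Longrightarrow> t < 2 * pi \<Longrightarrow> Arg2pi (cis t) = t"
  by (rule Arg2pi_unique[of 1]) (auto simp: cis_conv_exp)

lemma cis_Arg2pi: "z \<in> circle \<Longrightarrow> cis (Arg2pi z) = z"
  using complex_norm_eq_1_exp[of z] by (simp add: cis_conv_exp)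

lemma one_less_2pi: "1 < 2 * pi"
  using pi_gt3 by simp

text \<open>A function that is periodic off the unit interval needs no reduction of the angle on a
  window longer than a full period.\<close>

lemma angle_window:
  assumes "1 - 2 * pi < t - 2 * pi * of_int k" "t - 2 * pi * of_int k < 2 * pi"
    and "\<And>s. s < 0 \<or> 1 < s \<Longrightarrow> h s = h' s" "\<And>s. h' (s + 2 * pi) = h' s"
  shows "h (Arg2pi (cis t)) = h (t - 2 * pi * of_int k)"
proof -
  define s where "s = t - 2 * pi * of_int k"
  have "cis t = cis s * cis (2 * pi * of_int k)" unfolding cis_mult s_def by simp
  also have "cis (2 * pi * of_int k) = 1" by (rule cis_multiple_2pi) simp
  finally have cs: "cis t = cis s" by simp
  show ?thesis
  proof (cases "0 \<le> s")
    case True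
    then show ?thesis using Arg2pi_cis[of s] assms by (simp add: cs s_def)
  next
    case False
    \<comment> \<open>Here \<open>s < 0\<close> and \<open>s + 2 * pi > 1\<close>, so
      \<open>h\<close> may be replaced by the periodic \<open>h'\<close> at both points.\<close>
    have "cis s = cis (s + 2 * pi)" by (simp add: cis_mult[symmetric])
    then have "Arg2pi (cis t) = s + 2 * pi" using Arg2pi_cis[of "s + 2 * pi"] False assms(1,2)
      by (simp add: cs s_def)
    then show ?thesis using assms(3)[of s] assms(3)[of "s + 2 * pi"] assms(4)[of s] False assms(1)
      unfolding s_def[symmetric] by (simp add: s_def)
  qed
qed

text \<open>Maps of the whole line that are the identity outside the unit interval serve the line,
  the interval and the circle at once.\<close>

locale interval_action = group G for G :: "('a, 'c) monoid_scheme" (structure) +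
  fixes F :: "'a \<Rightarrow> real \<Rightarrow> real"
  assumes F_mult: "a \<in> carrier G \<Longrightarrow> b \<in> carrier G \<Longrightarrow> F (a \<otimes> b) x = F a (F b x)"
    and F_one: "F \<one> x = x"
    and F_faithful: "a \<in> carrier G \<Longrightarrow> a \<noteq> \<one> \<Longrightarrow> \<exists>x. F a x \<noteq> x"
    and F_outside: "a \<in> carrier G \<Longrightarrow> x \<le> 0 \<or> 1 \<le> x \<Longrightarrow> F a x = x"
    and F_C1: "a \<in> carrier G \<Longrightarrow>
      \<exists>D. continuous_on UNIV D \<and> (\<forall>x. 0 < D x \<and> (F a has_real_derivative D x) (at x))"
begin

lemma F_mono:
  assumes "a \<in> carrier G" "x \<le> y"
  shows "F a x \<le> F a y"
proof -
  obtain D where D: "\<And>x. 0 < D x" "\<And>x. (F a has_real_derivative D x) (at x)"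
    using F_C1[OF assms(1)] by blast
  show ?thesis
  proof (rule DERIV_nonneg_imp_nondecreasing[OF assms(2)])
    show "\<exists>d. (F a has_real_derivative d) (at u) \<and> 0 \<le> d" for u
      using D[of u] by (intro exI[of _ "D u"]) simp
  qed
qed

lemma F_unit: "a \<in> carrier G \<Longrightarrow> 0 \<le> x \<Longrightarrow> x \<le> 1 \<Longrightarrow> 0 \<le> F a x \<and> F a x \<le> 1"
  using F_mono[of a 0 x] F_mono[of a x 1] F_outside[of a 0] F_outside[of a 1] by auto

lemma F_faithful_unit: "a \<in> carrier G \<Longrightarrow> a \<noteq> \<one> \<Longrightarrow> \<exists>x. 0 \<le> x \<and> x \<le> 1 \<and> F a x \<noteq> x"
  using F_faithful F_outside by (metis linear)

lemma isomorphic_to_subgroup_Diff1_real: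
  assumes maps: "\<And>a x. a \<in> carrier G \<Longrightarrow> x \<in> S \<Longrightarrow> F a x \<in> S" and S: "{0..1} \<subseteq> S"
  shows "isomorphic_to_subgroup G (Diff1_real S)"
  unfolding Diff1_real_def
proof (rule faithful_action_isomorphic_to_subgroup[of "\<lambda>a. restrict (F a) S"])
  fix a assume a: "a \<in> carrier G" and bij: "restrict (F a) S \<in> Bij S"
    and inv: "\<And>x. x \<in> S \<Longrightarrow> inv_into S (restrict (F a) S) x = restrict (F (inv a)) S x"
  have C1: "C1_within S f" if b: "b \<in> carrier G" and f: "\<And>x. x \<in> S \<Longrightarrow> f x = F b x" for b f
  proof -
    obtain D where D: "continuous_on UNIV D" "\<And>x. (F b has_real_derivative D x) (at x)"
      using F_C1[OF b] by blast
    have "(f has_vector_derivative D x) (at x within S)" if x: "x \<in> S" for x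
    proof (rule has_vector_derivative_transform[OF x f])
      show "(F b has_vector_derivative D x) (at x within S)"
        using D(2)[of x] has_vector_derivative_at_within
        unfolding has_real_derivative_iff_has_vector_derivative by blast
    qed
    then show ?thesis unfolding C1_within_def
      using continuous_on_subset[OF D(1)] by (intro exI[of _ D]) auto
  qed
  obtain D where D: "\<And>x. 0 < D x" "\<And>x. (F a has_real_derivative D x) (at x)"
    using F_C1[OF a] by blast
  have "(restrict (F a) S has_real_derivative D x) (at x within S)" if "x \<in> S" for x
    by (rule has_field_derivative_transform_within[OF has_field_derivative_at_within[OF D(2)]
          zero_less_one that]) simp
  then have "\<forall>x\<in>S. \<exists>d>0. (restrict (F a) S has_real_derivative d) (at x within S)"
    using D(1) by blast
  then show "restrict (F a) S \<in> {f \<in> Bij S. C1_within S f \<and> C1_within S (inv_into S f) \<and>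
        (\<forall>x\<in>S. \<exists>d>0. (f has_real_derivative d) (at x within S))}"
    using bij C1[OF a, of "restrict (F a) S"] C1[OF inv_closed[OF a], of "inv_into S (restrict (F a) S)"] inv
    by simp
next
  fix a assume "a \<in> carrier G" "a \<noteq> \<one>"
  then show "\<exists>x\<in>S. restrict (F a) S x \<noteq> x" using F_faithful_unit[of a] S by (auto simp: subset_iff)
qed (use maps F_mult F_one in auto)

section \<open>The action on the circle\<close>

lemma F_less_2pi:
  assumes "a \<in> carrier G" "0 \<le> t" "t < 2 * pi"
  shows "0 \<le> F a t" "F a t < 2 * pi"
proof -
  have "0 \<le> F a t \<and> F a t < 2 * pi"
  proof (cases "t \<le> 1")
    case True
    then show ?thesis using F_unit[OF assms(1,2)] one_less_2pi by auto
  next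
    case False
    then show ?thesis using F_outside[OF assms(1), of t] assms by auto
  qed
  then show "0 \<le> F a t" "F a t < 2 * pi" by auto
qed

text \<open>The unit interval becomes the arc of angles from \<open>0\<close> to \<open>1\<close>,
  without rescaling because \<open>1 < 2 * pi\<close>; for an action as above the rest of the circle
  is fixed.\<close>

definition circle_map :: "'a \<Rightarrow> complex \<Rightarrow> complex" where
  "circle_map a = (\<lambda>z\<in>circle. cis (F a (Arg2pi z)))"

lemma circle_map_cis: "circle_map a (cis t) = cis (F a (Arg2pi (cis t)))"
  by (simp add: circle_map_def)

text \<open>\<open>Arg2pi\<close> jumps at angle \<open>0\<close>, so the lift is studied on
  overlapping windows, on each of which it is \<open>F a\<close> after a translation by a multiple
  of \<open>2 * pi\<close>.\<close>

lemma circle_map_C1: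
  assumes a: "a \<in> carrier G"
  shows "\<exists>r. continuous_on UNIV r \<and> (\<forall>t. 0 < r t \<and>
    ((circle_map a \<circ> cis) has_vector_derivative r t *\<^sub>R (\<i> * circle_map a (cis t))) (at t))"
proof -
  obtain D where D: "continuous_on UNIV D" "\<And>x. 0 < D x" "\<And>x. (F a has_real_derivative D x) (at x)"
    using F_C1[OF a] by blast
  have D1: "D x = 1" if "x < 0 \<or> 1 < x" for x
  proof -
    have "(F a has_real_derivative 1) (at x)"
      by (rule has_field_derivative_transform_within_open[OF DERIV_ident, of "if x < 0 then {..<0} else {1<..}"])
        (use that F_outside[OF a] in \<open>auto split: if_splits\<close>)
    then show ?thesis using D(3) DERIV_unique by blast
  qed
  define r where "r t = D (Arg2pi (cis t))" for t
  \<comment> \<open>Each window exceeds a period and reaches below \<open>2 * pi * k\<close>, so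
    these jump points are interior to a window.\<close>
  define U where "U k = {t. 1 - 2 * pi < t - 2 * pi * of_int k \<and> t - 2 * pi * of_int k < 2 * pi}" for k :: int
  have U: "open (U k)" for k
    unfolding U_def by (intro open_Collect_conj open_Collect_less continuous_intros)
  have cover: "\<exists>k. t \<in> U k" for t
  proof -
    define u where "u = t / (2 * pi)"
    have t: "t = 2 * pi * u" by (simp add: u_def)
    have "2 * pi * of_int \<lfloor>u\<rfloor> \<le> 2 * pi * u" by (intro mult_left_mono) auto
    moreover have "2 * pi * u < 2 * pi * (of_int \<lfloor>u\<rfloor> + 1)"
      by (intro mult_strict_left_mono) (linarith, simp)
    ultimately have "t \<in> U \<lfloor>u\<rfloor>"
      using one_less_2pi unfolding U_def t mem_Collect_eq distrib_left mult_1_right by linarith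
    then show ?thesis ..
  qed
  have r_U: "r t = D (t - 2 * pi * of_int k)" if "t \<in> U k" for t k
    unfolding r_def by (rule angle_window[where h' = "\<lambda>_. 1"]) (use that D1 in \<open>auto simp: U_def\<close>)
  have map_U: "circle_map a (cis t) = cis (F a (t - 2 * pi * of_int k))" if "t \<in> U k" for t k
    unfolding circle_map_cis
    by (rule angle_window[where h = "\<lambda>s. cis (F a s)" and h' = cis])
      (use that F_outside[OF a] in \<open>auto simp: U_def cis_mult[symmetric]\<close>)
  have "isCont r t" for t
  proof -
    obtain k where k: "t \<in> U k" using cover by blast
    have "continuous_on UNIV (\<lambda>t. D (t - 2 * pi * of_int k))"
      by (rule continuous_on_compose2[OF D(1)]) (auto intro!: continuous_intros)
    then have "continuous_on (U k) r"
      using r_U by (subst continuous_on_cong[OF refl r_U]) (auto intro: continuous_on_subset)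
    then show ?thesis using k U continuous_on_eq_continuous_at by blast
  qed
  then have "continuous_on UNIV r" by (simp add: continuous_at_imp_continuous_on)
  moreover have "((circle_map a \<circ> cis) has_vector_derivative r t *\<^sub>R (\<i> * circle_map a (cis t))) (at t)" for t
  proof -
    obtain k where k: "t \<in> U k" using cover by blast
    have "((\<lambda>t. F a (t - 2 * pi * of_int k)) has_real_derivative D (t - 2 * pi * of_int k) * 1) (at t)"
      by (rule DERIV_chain2[OF D(3)]) (auto intro!: derivative_eq_intros)
    then have "((\<lambda>t. cis (F a (t - 2 * pi * of_int k))) has_derivative
        (\<lambda>u. (r t * u) *\<^sub>R (\<i> * cis (F a (t - 2 * pi * of_int k))))) (at t)"
      unfolding r_U[OF k] has_field_derivative_def by (intro has_derivative_cis) simp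
    then have "((\<lambda>t. cis (F a (t - 2 * pi * of_int k))) has_vector_derivative
        r t *\<^sub>R (\<i> * circle_map a (cis t))) (at t)"
      unfolding map_U[OF k] has_vector_derivative_def by (simp add: mult.commute)
    then show ?thesis
      by (rule has_vector_derivative_transform_within_open[OF _ U k]) (simp add: map_U)
  qed
  ultimately show ?thesis using D(2) unfolding r_def by blast
qed

lemma isomorphic_to_subgroup_Diff1_circle: "isomorphic_to_subgroup G Diff1_circle"
  unfolding Diff1_circle_def
proof (rule faithful_action_isomorphic_to_subgroup[of circle_map])
  fix a assume a: "a \<in> carrier G" and bij: "circle_map a \<in> Bij circle"
    and inv: "\<And>z. z \<in> circle \<Longrightarrow> inv_into circle (circle_map a) z = circle_map (inv a) z"
  have C1: "C1_within UNIV (circle_map b \<circ> cis)" if b: "b \<in> carrier G" for b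
  proof -
    obtain r where r: "continuous_on UNIV r"
      "\<And>t. ((circle_map b \<circ> cis) has_vector_derivative r t *\<^sub>R (\<i> * circle_map b (cis t))) (at t)"
      using circle_map_C1[OF b] by blast
    have "continuous_on UNIV (circle_map b \<circ> cis)"
      by (intro continuous_at_imp_continuous_on ballI has_vector_derivative_continuous[OF r(2)])
    then have "continuous_on UNIV (\<lambda>t. r t *\<^sub>R (\<i> * circle_map b (cis t)))"
      by (intro continuous_intros r(1)) (simp add: o_def)
    then show ?thesis unfolding C1_within_def using r(2) by blast
  qed
  have "inv_into circle (circle_map a) \<circ> cis = circle_map (inv a) \<circ> cis"
    using inv by (simp add: fun_eq_iff)
  then show "circle_map a \<in> {f \<in> Bij circle. C1_within UNIV (f \<circ> cis) \<and>
      C1_within UNIV (inv_into circle f \<circ> cis) \<and>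
      (\<forall>t. \<exists>r>0. ((f \<circ> cis) has_vector_derivative r *\<^sub>R (\<i> * f (cis t))) (at t))}"
    using bij C1[OF a] C1[OF inv_closed[OF a]] circle_map_C1[OF a] by auto
next
  fix a assume "a \<in> carrier G" "a \<noteq> \<one>"
  then obtain x where x: "0 \<le> x" "x \<le> 1" "F a x \<noteq> x" using F_faithful_unit by blast
  have x': "x < 2 * pi" using x one_less_2pi by simp
  have "circle_map a (cis x) \<noteq> cis x"
  proof
    assume "circle_map a (cis x) = cis x"
    then have "Arg2pi (cis (F a x)) = Arg2pi (cis x)"
      using Arg2pi_cis[OF x(1) x'] by (simp add: circle_map_cis)
    then show False
      using F_less_2pi[OF \<open>a \<in> carrier G\<close> x(1) x'] Arg2pi_cis x x' by simp
  qed
  then show "\<exists>z\<in>circle. circle_map a z \<noteq> z" by (intro bexI[of _ "cis x"]) auto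
next
  fix a b z assume "a \<in> carrier G" "b \<in> carrier G" "z \<in> circle"
  then show "circle_map (a \<otimes> b) z = circle_map a (circle_map b z)"
    using F_less_2pi[of b "Arg2pi z"] Arg2pi_ge_0[of z] Arg2pi_lt_2pi[of z]
    by (simp add: circle_map_def F_mult Arg2pi_cis)
next
  fix z assume z: "z \<in> circle"
  then show "circle_map \<one> z = z" by (simp add: circle_map_def F_one cis_Arg2pi del: mem_sphere)
qed (auto simp: circle_map_def)

lemma isomorphic_to_subgroup_Diff1:
  "isomorphic_to_subgroup G (Diff1_real UNIV) \<and> isomorphic_to_subgroup G Diff1_circle \<and>
   isomorphic_to_subgroup G (Diff1_real {0..1})"
  using F_unit
  by (intro conjI isomorphic_to_subgroup_Diff1_real isomorphic_to_subgroup_Diff1_circle) auto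

end

section \<open>From residual nilpotence to an ordered action\<close>

text \<open>An enumeration of the set supplies the labels and division by the total weight
  normalizes the lengths. Finiteness of the exceptional sets is the limit condition of
  \<open>admissible\<close>, as it does not depend on the enumeration.\<close>

lemma (in group) ordered_action_to_interval_action:
  fixes \<Omega> :: "'w set" and act :: "'a \<Rightarrow> 'w \<Rightarrow> 'w" and w :: "'w \<Rightarrow> real"
  assumes \<Omega>: "countable \<Omega>" "infinite \<Omega>"
    and maps: "\<And>a x. a \<in> carrier G \<Longrightarrow> x \<in> \<Omega> \<Longrightarrow> act a x \<in> \<Omega>"
    and mult: "\<And>a b x. a \<in> carrier G \<Longrightarrow> b \<in> carrier G \<Longrightarrow> x \<in> \<Omega> \<Longrightarrow> act (a \<otimes> b) x = act a (act b x)"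
    and one: "\<And>x. x \<in> \<Omega> \<Longrightarrow> act \<one> x = x"
    and faithful: "\<And>a. a \<in> carrier G \<Longrightarrow> a \<noteq> \<one> \<Longrightarrow> \<exists>x\<in>\<Omega>. act a x \<noteq> x"
    and irrefl: "\<And>x. x \<in> \<Omega> \<Longrightarrow> \<not> lt x x"
    and trans: "\<And>x y z. x \<in> \<Omega> \<Longrightarrow> y \<in> \<Omega> \<Longrightarrow> z \<in> \<Omega> \<Longrightarrow> lt x y \<Longrightarrow> lt y z \<Longrightarrow> lt x z"
    and total: "\<And>x y. x \<in> \<Omega> \<Longrightarrow> y \<in> \<Omega> \<Longrightarrow> x \<noteq> y \<Longrightarrow> lt x y \<or> lt y x"
    and mono: "\<And>a x y. a \<in> carrier G \<Longrightarrow> x \<in> \<Omega> \<Longrightarrow> y \<in> \<Omega> \<Longrightarrow> lt x y \<Longrightarrow> lt (act a x) (act a y)"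
    and w_pos: "\<And>x. x \<in> \<Omega> \<Longrightarrow> 0 < w x" and w_sum: "w summable_on \<Omega>"
    and ratio: "\<And>a \<delta>. a \<in> carrier G \<Longrightarrow> 0 < \<delta> \<Longrightarrow> finite {x \<in> \<Omega>. \<delta> < \<bar>w (act a x) / w x - 1\<bar>}"
  shows "\<exists>F. interval_action G F"
proof -
  define e where "e = from_nat_into \<Omega>"
  define d where "d = to_nat_on \<Omega>"
  have bij: "bij_betw e UNIV \<Omega>" unfolding e_def using \<Omega> by (rule bij_betw_from_nat_into)
  have e: "e n \<in> \<Omega>" for n using bij by (auto simp: bij_betw_def)
  have de [simp]: "d (e n) = n" for n
    unfolding d_def e_def using \<Omega> by (rule to_nat_on_from_nat_into_infinite)
  have ed [simp]: "e (d x) = x" if "x \<in> \<Omega>" for x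
    unfolding d_def e_def using \<Omega> that by simp
  have inj: "inj e" using bij by (simp add: bij_betw_def)
  define L where "L = infsum w \<Omega>"
  have we: "((\<lambda>n. w (e n)) has_sum L) UNIV"
    unfolding has_sum_reindex_bij_betw[OF bij] L_def using w_sum by simp
  have "sum (\<lambda>n. w (e n)) {0} \<le> L"
    by (rule has_sum_mono2[OF has_sum_finite we]) (use w_pos e in \<open>auto simp: less_imp_le\<close>)
  then have L: "0 < L" using w_pos[OF e, of 0] by simp
  define prec where "prec m n \<longleftrightarrow> lt (e m) (e n)" for m n
  define l where "l n = w (e n) / L" for n
  interpret weighted_order prec l
  proof
    show "l sums 1"
      using sums_divide[OF has_sum_imp_sums[OF we], of L] L by (simp add: l_def[abs_def])
    show "prec m n \<or> prec n m" if "m \<noteq> n" for m n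
      using total[OF e e, of m n] that inj by (auto simp: prec_def dest: injD)
    show "prec k n" if "prec k m" "prec m n" for k m n
      using that trans[OF e e e, of k m n] by (simp add: prec_def)
  qed (use L w_pos e irrefl in \<open>auto simp: prec_def l_def\<close>)
  define \<sigma> where "\<sigma> a n = d (act a (e n))" for a n
  have e\<sigma>: "e (\<sigma> a n) = act a (e n)" if "a \<in> carrier G" for a n
    using maps[OF that e] by (simp add: \<sigma>_def)
  have \<sigma>_mult: "\<sigma> (a \<otimes> b) = \<sigma> a \<circ> \<sigma> b" if "a \<in> carrier G" "b \<in> carrier G" for a b
    using mult[OF that e] e\<sigma>[OF that(2)] by (simp add: \<sigma>_def fun_eq_iff)
  have \<sigma>_one: "\<sigma> \<one> = id" using one[OF e] by (simp add: \<sigma>_def fun_eq_iff)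
  have adm: "admissible (\<sigma> a)" if a: "a \<in> carrier G" for a
    unfolding admissible_def
  proof (intro conjI allI impI)
    show "bij (\<sigma> a)"
      using \<sigma>_mult[of a "inv a"] \<sigma>_mult[of "inv a" a] a \<sigma>_one by (intro o_bij[of "\<sigma> (inv a)"]) auto
    show "prec (\<sigma> a m) (\<sigma> a n)" if "prec m n" for m n
      using that mono[OF a e e] by (simp add: prec_def e\<sigma>[OF a])
    show "(\<lambda>n. l (\<sigma> a n) / l n) \<longlonglongrightarrow> 1"
    proof (rule tendstoI)
      fix \<delta> :: real assume "0 < \<delta>"
      \<comment> \<open>Failure of \<open>dist < \<delta>\<close> gives only a weak inequality,
        whereas the exceptional sets are defined by a strict one; halving bridges the gap.\<close>
      have "finite (e -` {x \<in> \<Omega>. \<delta> / 2 < \<bar>w (act a x) / w x - 1\<bar>})"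
        using ratio[OF a, of "\<delta> / 2"] \<open>0 < \<delta>\<close> by (intro finite_vimageI inj) simp
      moreover have "{n. \<not> dist (l (\<sigma> a n) / l n) 1 < \<delta>} \<subseteq> e -` {x \<in> \<Omega>. \<delta> / 2 < \<bar>w (act a x) / w x - 1\<bar>}"
        using \<open>0 < \<delta>\<close> L e by (auto simp: l_def e\<sigma>[OF a] dist_real_def)
      ultimately show "\<forall>\<^sub>F n in sequentially. dist (l (\<sigma> a n) / l n) 1 < \<delta>"
        unfolding cofinite_eq_sequentially[symmetric] eventually_cofinite by (rule finite_subset[rotated])
    qed
  qed
  have "interval_action G (\<lambda>a. realization (\<sigma> a))"
  proof
    show "realization (\<sigma> (a \<otimes> b)) x = realization (\<sigma> a) (realization (\<sigma> b) x)"
      if "a \<in> carrier G" "b \<in> carrier G" for a b x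
      using realization_compose[of "\<sigma> b" "\<sigma> a" x] adm that adm[of "a \<otimes> b"] \<sigma>_mult[OF that] by simp
    show "realization (\<sigma> \<one>) x = x" for x by (simp add: \<sigma>_one realization_id)
    show "\<exists>x. realization (\<sigma> a) x \<noteq> x" if a: "a \<in> carrier G" "a \<noteq> \<one>" for a
    proof -
      obtain x where x: "x \<in> \<Omega>" "act a x \<noteq> x" using faithful[OF a] by blast
      then have "\<sigma> a (d x) \<noteq> d x" using ed maps[OF a(1)] unfolding \<sigma>_def by metis
      then show ?thesis using realization_nontrivial[OF adm[OF a(1)]] by blast
    qed
  qed (use adm realization_outside realization_C1 in auto)
  then show ?thesis by blast
qed

lemma (in group) finitely_generated_countable:
  assumes "finite A" "A \<subseteq> carrier G" "generate G A = carrier G"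
  shows "countable (carrier G)"
proof -
  let ?X = "A \<union> m_inv G ` A"
  have X: "?X \<subseteq> carrier G" "finite ?X" using assms by auto
  have "generate G A \<subseteq> generate G ?X" by (rule mono_generate) simp
  also have "\<dots> = (\<Union>n. word_ball G ?X n)"
    using assms by (intro generate_eq_word_balls X) auto
  finally have "carrier G \<subseteq> (\<Union>n. word_ball G ?X n)" using assms by simp
  moreover have "countable (\<Union>n. word_ball G ?X n)"
    using word_ball_finite[OF X(2)] by (intro countable_UN) (auto intro: countable_finite)
  ultimately show ?thesis by (rule countable_subset)
qed

lemma ex_interval_action:
  fixes G :: "('a, 'c) monoid_scheme"
  assumes "group G" and fg: "finitely_generated_group G"
    and res: "residually_torsion_free_nilpotent TYPE('b) G"
  shows "\<exists>F. interval_action G F"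
proof -
  interpret group G by fact
  show ?thesis
  proof (cases "carrier G = {\<one>\<^bsub>G\<^esub>}")
    \<comment> \<open>The trivial group is treated apart, since it has no nontrivial elements to
      enumerate.\<close>
    case True
    have "interval_action G (\<lambda>_ x. x)"
    proof
      show "\<exists>D. continuous_on UNIV D \<and> (\<forall>x. 0 < D x \<and> ((\<lambda>x. x) has_real_derivative D x) (at x))"
        by (rule exI[of _ "\<lambda>_. 1"]) auto
    qed (use True in auto)
    then show ?thesis by blast
  next
    case nontrivial: False
    obtain A where A: "finite A" "A \<subseteq> carrier G" "generate G A = carrier G"
      using fg by (auto simp: finitely_generated_group_def)
    have cnt: "countable (carrier G)" using A by (rule finitely_generated_countable)
    have ne: "carrier G - {\<one>\<^bsub>G\<^esub>} \<noteq> {}" using nontrivial by blast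
    \<comment> \<open>\<open>g\<close> lists the elements to be detected, one by each
      \<open>N i\<close>; \<open>e\<close> lists those whose ratios are controlled. Only
      surjectivity is used, so repetitions do no harm.\<close>
    define g where "g = from_nat_into (carrier G - {\<one>\<^bsub>G\<^esub>})"
    define e where "e = from_nat_into (carrier G)"
    have g: "g i \<in> carrier G" "g i \<noteq> \<one>\<^bsub>G\<^esub>" for i
      using from_nat_into[OF ne, of i] by (auto simp: g_def)
    have g_range: "\<exists>i. g i = a" if "a \<in> carrier G" "a \<noteq> \<one>\<^bsub>G\<^esub>" for a
      using from_nat_into_surj[of "carrier G - {\<one>\<^bsub>G\<^esub>}" a] cnt that unfolding g_def by blast
    have e: "e i \<in> carrier G" for i
      unfolding e_def by (rule from_nat_into) auto
    have e_range: "\<exists>i. e i = a" if "a \<in> carrier G" for a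
      using from_nat_into_surj[OF cnt that] unfolding e_def by blast
    have "\<forall>i. \<exists>p :: 'b monoid \<times> ('a \<Rightarrow> 'b). torsion_free_group (fst p) \<and> nilpotent_group (fst p) \<and>
        snd p \<in> hom G (fst p) \<and> snd p (g i) \<noteq> \<one>\<^bsub>fst p\<^esub>"
      using res g unfolding residually_torsion_free_nilpotent_def by (metis fst_conv snd_conv)
    then obtain p :: "nat \<Rightarrow> 'b monoid \<times> ('a \<Rightarrow> 'b)" where
      p: "\<And>i. torsion_free_group (fst (p i))" "\<And>i. nilpotent_group (fst (p i))"
        "\<And>i. snd (p i) \<in> hom G (fst (p i))" "\<And>i. snd (p i) (g i) \<noteq> \<one>\<^bsub>fst (p i)\<^esub>"
      by metis
    define N where "N i = fst (p i)" for i
    define \<phi> where "\<phi> i = snd (p i)" for i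
    have N: "torsion_free_group (N i)" "nilpotent_group (N i)" "group (N i)" for i
      using p by (auto simp: N_def nilpotent_group_def)
    have hom: "group_hom G (N i) (\<phi> i)" for i
      using N(3)[of i] p(3)[of i] by (simp add: group_hom_def group_hom_axioms_def N_def \<phi>_def)
    have \<phi>g: "\<phi> i (g i) \<noteq> \<one>\<^bsub>N i\<^esub>" for i using p(4) by (simp add: N_def \<phi>_def)
    define H where "H i = \<phi> i ` carrier G" for i
    have H_gen: "H i = generate (N i) (\<phi> i ` A)" for i
      using group_hom.generate_img[OF hom A(2)] A(3) by (simp add: H_def)
    have H: "subgroup (H i) (N i)" for i
      unfolding H_def by (rule group_hom.img_is_subgroup[OF hom])
    have \<phi>H: "\<phi> i a \<in> H i" if "a \<in> carrier G" for i a using that by (simp add: H_def)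
    have Hc: "h \<in> carrier (N i)" if "h \<in> H i" for i h using subgroup.mem_carrier[OF H that] .
    \<comment> \<open>A fixed element \<open>e j\<close> is controlled on every \<open>H i\<close>
      with \<open>i >= j\<close>, with a tolerance that tends to \<open>0\<close>.\<close>
    have "\<forall>i. \<exists>l::'b \<Rightarrow> real. (\<forall>h. 0 < l h) \<and> l summable_on H i \<and>
      (\<forall>t\<in>\<phi> i ` e ` {..i}. \<forall>h\<in>H i. \<bar>l (t \<otimes>\<^bsub>N i\<^esub> h) / l h - 1\<bar> \<le> 1 / (real i + 1)) \<and>
      (\<forall>t\<in>H i. \<forall>\<delta>>0. finite {h \<in> H i. \<delta> < \<bar>l (t \<otimes>\<^bsub>N i\<^esub> h) / l h - 1\<bar>})"
      unfolding H_gen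
    proof (intro allI group.nilpotent_almost_invariant_weight N)
      fix i
      show "finite (\<phi> i ` A)" using A by simp
      show "\<phi> i ` A \<subseteq> carrier (N i)" using A Hc \<phi>H by blast
      show "\<phi> i ` e ` {..i} \<subseteq> generate (N i) (\<phi> i ` A)" using \<phi>H e unfolding H_gen[symmetric] by blast
    qed auto
    from choice[OF this] obtain l :: "nat \<Rightarrow> 'b \<Rightarrow> real" where
      l: "\<And>i. (\<forall>h. 0 < l i h) \<and> l i summable_on H i \<and>
      (\<forall>t\<in>\<phi> i ` e ` {..i}. \<forall>h\<in>H i. \<bar>l i (t \<otimes>\<^bsub>N i\<^esub> h) / l i h - 1\<bar> \<le> 1 / (real i + 1)) \<and>
      (\<forall>t\<in>H i. \<forall>\<delta>>0. finite {h \<in> H i. \<delta> < \<bar>l i (t \<otimes>\<^bsub>N i\<^esub> h) / l i h - 1\<bar>})"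
      by blast
    have l_pos: "0 < l i h" and l_sum: "l i summable_on H i" for i h using l by blast+
    have l_near: "\<bar>l i (\<phi> i (e j) \<otimes>\<^bsub>N i\<^esub> h) / l i h - 1\<bar> \<le> 1 / (real i + 1)"
      if "j \<le> i" "h \<in> H i" for i j h
      using l[of i] that by simp
    have l_fin: "finite {h \<in> H i. \<delta> < \<bar>l i (t \<otimes>\<^bsub>N i\<^esub> h) / l i h - 1\<bar>}"
      if "t \<in> H i" "0 < \<delta>" for i t \<delta>
      using l[of i] that by blast
    obtain P where P: "\<And>i. P i \<subseteq> carrier (N i)" "\<And>i r s. r \<in> P i \<Longrightarrow> s \<in> P i \<Longrightarrow> r \<otimes>\<^bsub>N i\<^esub> s \<in> P i"
      "\<And>i. \<one>\<^bsub>N i\<^esub> \<notin> P i"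
      "\<And>i x. x \<in> carrier (N i) \<Longrightarrow> x = \<one>\<^bsub>N i\<^esub> \<or> x \<in> P i \<or> inv\<^bsub>N i\<^esub> x \<in> P i"
      using group.torsion_free_nilpotent_positive_cone[OF N(3,1,2)] by metis
    define \<Omega> where "\<Omega> = Sigma UNIV H"
    define act where "act a x = (fst x, \<phi> (fst x) a \<otimes>\<^bsub>N (fst x)\<^esub> snd x)" for a and x :: "nat \<times> 'b"
    \<comment> \<open>Within one component this is the left order of the cone: \<open>h^-1 k\<close>
      does not change when \<open>h\<close> and \<open>k\<close> are multiplied on the left by the
      same element.\<close>
    define lt where "lt x y \<longleftrightarrow> fst x < fst y \<or>
      fst x = fst y \<and> inv\<^bsub>N (fst x)\<^esub> snd x \<otimes>\<^bsub>N (fst x)\<^esub> snd y \<in> P (fst x)" for x y :: "nat \<times> 'b"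
    \<comment> \<open>The total weight of component \<open>i\<close> becomes at most
      \<open>(1 / 2)^i\<close>; the added \<open>1\<close> keeps the denominator positive from
      nonnegativity alone. The factor cancels in ratios, because the action preserves
      components.\<close>
    define c where "c i = (1 / 2) ^ i / (1 + infsum (l i) (H i))" for i
    define w where "w x = c (fst x) * l (fst x) (snd x)" for x :: "nat \<times> 'b"
    have S_nonneg: "0 \<le> infsum (l i) (H i)" for i
      using l_pos by (intro infsum_nonneg) (simp add: less_imp_le)
    have c_pos: "0 < c i" for i using S_nonneg[of i] by (simp add: c_def add_pos_nonneg)
    have w_ratio: "w (act a (i, h)) / w (i, h) = l i (\<phi> i a \<otimes>\<^bsub>N i\<^esub> h) / l i h" for a i h
      using c_pos[of i] by (simp add: w_def act_def)
    show ?thesis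
    proof (rule ordered_action_to_interval_action[of \<Omega> act lt w])
      show "countable \<Omega>"
        unfolding \<Omega>_def H_def using cnt by (intro countable_SIGMA) auto
      have "inj (\<lambda>i. (i, \<one>\<^bsub>N i\<^esub>))" by (auto intro: injI)
      moreover have "range (\<lambda>i. (i, \<one>\<^bsub>N i\<^esub>)) \<subseteq> \<Omega>"
        using subgroup.one_closed[OF H] by (auto simp: \<Omega>_def)
      ultimately show "infinite \<Omega>" using infinite_super range_inj_infinite by blast
    next
      fix a x assume "a \<in> carrier G" "x \<in> \<Omega>"
      then show "act a x \<in> \<Omega>"
        using subgroup.m_closed[OF H \<phi>H] by (auto simp: \<Omega>_def act_def)
    next
      fix a b x assume ab: "a \<in> carrier G" "b \<in> carrier G" "x \<in> \<Omega>"
      obtain i h where x: "x = (i, h)" "h \<in> H i" using ab(3) by (auto simp: \<Omega>_def)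
      interpret h: group_hom G "N i" "\<phi> i" by (rule hom)
      show "act (a \<otimes>\<^bsub>G\<^esub> b) x = act a (act b x)"
        using ab x Hc by (simp add: act_def h.m_assoc)
    next
      fix x assume "x \<in> \<Omega>"
      then obtain i h where x: "x = (i, h)" "h \<in> H i" by (auto simp: \<Omega>_def)
      interpret h: group_hom G "N i" "\<phi> i" by (rule hom)
      show "act \<one>\<^bsub>G\<^esub> x = x" using x Hc by (simp add: act_def)
      show "\<not> lt x x" using x Hc P(3) by (simp add: lt_def)
      show "0 < w x" using c_pos l_pos by (simp add: w_def)
    next
      fix a assume a: "a \<in> carrier G" "a \<noteq> \<one>\<^bsub>G\<^esub>"
      then obtain i where i: "g i = a" using g_range by blast
      interpret h: group_hom G "N i" "\<phi> i" by (rule hom)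
      have "act a (i, \<one>\<^bsub>N i\<^esub>) \<noteq> (i, \<one>\<^bsub>N i\<^esub>)" using \<phi>g[of i] a i by (simp add: act_def)
      then show "\<exists>x\<in>\<Omega>. act a x \<noteq> x"
        using subgroup.one_closed[OF H] by (intro bexI[of _ "(i, \<one>\<^bsub>N i\<^esub>)"]) (auto simp: \<Omega>_def)
    next
      fix x y z assume xyz: "x \<in> \<Omega>" "y \<in> \<Omega>" "z \<in> \<Omega>" and lt: "lt x y" "lt y z"
      show "lt x z"
      proof (cases "fst x = fst y \<and> fst y = fst z")
        case True
        define i where "i = fst x"
        interpret N: group "N i" by (rule N)
        have c: "snd x \<in> carrier (N i)" "snd y \<in> carrier (N i)" "snd z \<in> carrier (N i)"
          using xyz True Hc by (auto simp: \<Omega>_def i_def)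
        have "(inv\<^bsub>N i\<^esub> snd x \<otimes>\<^bsub>N i\<^esub> snd y) \<otimes>\<^bsub>N i\<^esub> (inv\<^bsub>N i\<^esub> snd y \<otimes>\<^bsub>N i\<^esub> snd z) \<in> P i"
          by (rule P(2)) (use lt True in \<open>auto simp: lt_def i_def\<close>)
        then show ?thesis using c True by (simp add: lt_def i_def[symmetric] N.word_simps)
      qed (use lt in \<open>auto simp: lt_def\<close>)
    next
      fix x y assume xy: "x \<in> \<Omega>" "y \<in> \<Omega>" "x \<noteq> y"
      show "lt x y \<or> lt y x"
      proof (cases "fst x = fst y")
        case True
        define i where "i = fst x"
        interpret N: group "N i" by (rule N)
        have c: "snd x \<in> carrier (N i)" "snd y \<in> carrier (N i)" "snd x \<noteq> snd y"
          using xy True Hc by (auto simp: \<Omega>_def i_def prod_eq_iff)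
        have "inv\<^bsub>N i\<^esub> snd x \<otimes>\<^bsub>N i\<^esub> snd y \<noteq> \<one>\<^bsub>N i\<^esub>"
          using c by (metis N.inv_closed N.inv_equality N.inv_inv)
        moreover have "inv\<^bsub>N i\<^esub> (inv\<^bsub>N i\<^esub> snd x \<otimes>\<^bsub>N i\<^esub> snd y) = inv\<^bsub>N i\<^esub> snd y \<otimes>\<^bsub>N i\<^esub> snd x"
          using c by (simp add: N.inv_mult_group)
        ultimately show ?thesis
          using P(4)[of "inv\<^bsub>N i\<^esub> snd x \<otimes>\<^bsub>N i\<^esub> snd y" i] c True
          by (auto simp: lt_def i_def[symmetric])
      qed (auto simp: lt_def)
    next
      fix a x y assume a: "a \<in> carrier G" and xy: "x \<in> \<Omega>" "y \<in> \<Omega>" and lt: "lt x y"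
      show "lt (act a x) (act a y)"
      proof (cases "fst x = fst y")
        case True
        define i where "i = fst x"
        interpret N: group "N i" by (rule N)
        have c: "snd x \<in> carrier (N i)" "snd y \<in> carrier (N i)" "\<phi> i a \<in> carrier (N i)"
          using xy True a Hc \<phi>H by (auto simp: \<Omega>_def i_def)
        have "inv\<^bsub>N i\<^esub> (\<phi> i a \<otimes>\<^bsub>N i\<^esub> snd x) \<otimes>\<^bsub>N i\<^esub> (\<phi> i a \<otimes>\<^bsub>N i\<^esub> snd y)
            = inv\<^bsub>N i\<^esub> snd x \<otimes>\<^bsub>N i\<^esub> snd y"
          using c by (simp add: N.word_simps)
        then show ?thesis using lt True by (simp add: lt_def act_def i_def[symmetric])
      qed (use lt in \<open>auto simp: lt_def act_def\<close>)
    next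
      define S where "S i = c i * infsum (l i) (H i)" for i
      have S_le: "S i \<le> (1 / 2) ^ i" for i
      proof -
        have "(1 / 2) ^ i * (infsum (l i) (H i) / (1 + infsum (l i) (H i))) \<le> (1 / 2) ^ i * (1 :: real)"
          using S_nonneg[of i] by (intro mult_left_mono) (auto simp: divide_le_eq_1)
        then show ?thesis by (simp add: S_def c_def)
      qed
      have "summable S"
        by (rule summable_comparison_test'[OF summable_geometric[of "1 / 2 :: real"]])
          (use S_le c_pos S_nonneg in \<open>auto simp: S_def less_imp_le\<close>)
      then have "S summable_on UNIV"
        using c_pos S_nonneg by (intro summable_nonneg_imp_summable_on) (auto simp: S_def less_imp_le)
      then show "w summable_on \<Omega>"
        unfolding \<Omega>_def
      proof (rule summable_on_SigmaI[rotated])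
        show "((\<lambda>h. w (i, h)) has_sum S i) (H i)" for i
          using has_sum_cmult_right[OF has_sum_infsum[OF l_sum[of i]], of "c i"] by (simp add: w_def S_def)
        show "0 \<le> w (i, h)" for i h using c_pos[of i] l_pos[of i h] by (simp add: w_def)
      qed
    next
      fix a and \<delta> :: real assume a: "a \<in> carrier G" and \<delta>: "0 < \<delta>"
      obtain j where j: "e j = a" using e_range[OF a] by blast
      obtain k where k: "1 / (real k + 1) < \<delta>"
        using reals_Archimedean[OF \<delta>] by (auto simp: inverse_eq_divide add.commute)
      let ?B = "\<lambda>i. {h \<in> H i. \<delta> < \<bar>l i (\<phi> i a \<otimes>\<^bsub>N i\<^esub> h) / l i h - 1\<bar>}"
      \<comment> \<open>From index \<open>j\<close> on the element is controlled, and from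
        \<open>k\<close> on the tolerance is below \<open>\<delta>\<close>; the finitely many
        earlier components have finite exceptional sets.\<close>
      have "i < max j k" if h: "h \<in> ?B i" for i h
      proof (rule ccontr)
        assume "\<not> ?thesis"
        then have i: "j \<le> i" "k \<le> i" by auto
        then have "1 / (real i + 1) \<le> 1 / (real k + 1)" by (intro divide_left_mono) auto
        then show False using l_near[OF i(1), of h] h j k by auto
      qed
      then have "{x \<in> \<Omega>. \<delta> < \<bar>w (act a x) / w x - 1\<bar>} \<subseteq> Sigma {..<max j k} ?B"
        by (auto simp: \<Omega>_def w_ratio)
      moreover have "finite (Sigma {..<max j k} ?B)"
        using l_fin[OF \<phi>H[OF a] \<delta>] by (intro finite_SigmaI) auto
      ultimately show "finite {x \<in> \<Omega>. \<delta> < \<bar>w (act a x) / w x - 1\<bar>}" by (rule finite_subset)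
    qed
  qed
qed

theorem theorem1p6:
  fixes G :: "('a, 'c) monoid_scheme"
  assumes "group G"
    and "finitely_generated_group G"
    and "residually_torsion_free_nilpotent TYPE('b) G"
  shows "isomorphic_to_subgroup G (Diff1_real UNIV)
    \<and> isomorphic_to_subgroup G Diff1_circle
    \<and> isomorphic_to_subgroup G (Diff1_real {0..1})"
proof -
  obtain F where "interval_action G F" using ex_interval_action[OF assms] by blast
  then show ?thesis by (rule interval_action.isomorphic_to_subgroup_Diff1)
qed

end
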